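(* Let \(\mathcal V\) be a universe. The following are equivalent: (i) there is a positive locally small \(\delta_{\mathcal V}\)-complete poset with \(\lnot\lnot\)-stable equality; (ii) there is a positive locally small \(\delta_{\mathcal V}\)-complete poset with decidable equality; (iii) excluded middle in \(\mathcal V\) holds.
   Context: Work in univalent foundations (intensional Martin-Löf type theory with universes, function and propositional extensionality, propositional truncations). "There is" means one can construct such a structure, with carrier in any universe. A poset is a type \(X\) with a proposition-valued reflexive, transitive, antisymmetric relation \(\sqsubseteq\). It is \(\delta_{\mathcal V}\)-complete if for all \(x\sqsubseteq y\) and every proposition \(P:\mathcal V\), the family \(\delta_{x,y,P}:\mathbf 1+P\to X\), \(\mathrm{inl}(\star)\mapsto x\), \(\mathrm{inr}(p)\mapsto y\), has a supremum \(\bigvee\delta_{x,y,P}\). In such a poset, \(x\) is strictly below \(y\) if \(x\sqsubseteq y\) and for every \(z\sqsupseteq y\) and every proposition \(P:\mathcal V\), \(z=\bigvee\delta_{x,z,P}\) implies \(P\). The poset is positive if it comes with designated \(x,y\) with \(x\) strictly below \(y\). It is locally small if there is a \(\mathcal V\)-valued relation \(\sqsubseteq_{\mathcal V}\) with \((x\sqsubseteq y)\simeq(x\sqsubseteq_{\mathcal V}y)\). Equality is \(\lnot\lnot\)-stable if \(\lnot\lnot(x=y)\to x=y\) for all \(x,y\), and decidable if \((x=y)+\lnot(x=y)\) for all \(x,y\). Excluded middle in \(\mathcal V\): every proposition \(P:\mathcal V\) satisfies \(P\) or \(\lnot P\). *)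

theory Defs
  imports Main
begin

text \<open>
  HOL is classical, so excluded middle is provable in it and a statement about excluded middle
  has content only relative to an object theory. Part 1 defines intensional Martin-Loef type theory
  with a hierarchy of universes, function extensionality, propositional extensionality and
  propositional truncation, as a deductive system. Part 2 writes the order-theoretic notions as
  types of that theory.
\<close>


section \<open>The type theory\<close>

text \<open>
  Variables are de Bruijn indices. The binders are: the codomain of
  \<open>Pi\<close> and \<open>Sig\<close> and the body of \<open>Lam\<close> (one variable); the motive of every eliminator
  (one variable; two for \<open>J\<close>: the endpoint and, innermost, the path; none for \<open>TrRec\<close>, which is
  non-dependent and takes a proof that its target is a proposition); the branches of
  \<open>CaseOf\<close> (one variable); the successor branch of \<open>NatRec\<close> (the predecessor and,
  innermost, the induction hypothesis).
\<close>

datatype tm =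
    Var nat
  | Univ nat
  | Pi tm tm | Lam tm | App tm tm  (infixl "\<cdot>" 90)
  | Sig tm tm | Tup tm tm | Proj1 tm | Proj2 tm
  | Coprod tm tm | InL tm | InR tm | CaseOf tm tm tm tm
  | Empty nat | Abort tm tm
  | Unit nat | Star nat | UnitRec tm tm tm
  | NatT | ZeroT | SucT tm | NatRec tm tm tm tm
  | Eq tm tm tm | Rfl tm | J tm tm tm tm tm tm
  | Trunc tm | TrIn tm | Squash tm tm | TrRec tm tm tm tm
  | Funext tm tm tm
  | Propext tm tm tm tm tm tm

definition up_ren :: "(nat \<Rightarrow> nat) \<Rightarrow> nat \<Rightarrow> nat" where
  "up_ren r = case_nat 0 (\<lambda>i. Suc (r i))"

primrec rename :: "(nat \<Rightarrow> nat) \<Rightarrow> tm \<Rightarrow> tm" where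
  "rename r (Var i) = Var (r i)"
| "rename r (Univ l) = Univ l"
| "rename r (Pi A B) = Pi (rename r A) (rename (up_ren r) B)"
| "rename r (Lam t) = Lam (rename (up_ren r) t)"
| "rename r (App f a) = App (rename r f) (rename r a)"
| "rename r (Sig A B) = Sig (rename r A) (rename (up_ren r) B)"
| "rename r (Tup a b) = Tup (rename r a) (rename r b)"
| "rename r (Proj1 p) = Proj1 (rename r p)"
| "rename r (Proj2 p) = Proj2 (rename r p)"
| "rename r (Coprod A B) = Coprod (rename r A) (rename r B)"
| "rename r (InL a) = InL (rename r a)"
| "rename r (InR b) = InR (rename r b)"
| "rename r (CaseOf C s t u) =
     CaseOf (rename (up_ren r) C) (rename (up_ren r) s) (rename (up_ren r) t) (rename r u)"
| "rename r (Empty l) = Empty l"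
| "rename r (Abort C e) = Abort (rename (up_ren r) C) (rename r e)"
| "rename r (Unit l) = Unit l"
| "rename r (Star l) = Star l"
| "rename r (UnitRec C c u) = UnitRec (rename (up_ren r) C) (rename r c) (rename r u)"
| "rename r NatT = NatT"
| "rename r ZeroT = ZeroT"
| "rename r (SucT n) = SucT (rename r n)"
| "rename r (NatRec C z s n) =
     NatRec (rename (up_ren r) C) (rename r z) (rename (up_ren (up_ren r)) s) (rename r n)"
| "rename r (Eq A a b) = Eq (rename r A) (rename r a) (rename r b)"
| "rename r (Rfl a) = Rfl (rename r a)"
| "rename r (J A a C d b p) =
     J (rename r A) (rename r a) (rename (up_ren (up_ren r)) C) (rename r d) (rename r b) (rename r p)"
| "rename r (Trunc A) = Trunc (rename r A)"
| "rename r (TrIn a) = TrIn (rename r a)"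
| "rename r (Squash s t) = Squash (rename r s) (rename r t)"
| "rename r (TrRec P h f t) = TrRec (rename r P) (rename r h) (rename r f) (rename r t)"
| "rename r (Funext f g h) = Funext (rename r f) (rename r g) (rename r h)"
| "rename r (Propext P Q h k f g) =
     Propext (rename r P) (rename r Q) (rename r h) (rename r k) (rename r f) (rename r g)"

abbreviation wk :: "tm \<Rightarrow> nat \<Rightarrow> tm"  (infixl "\<up>" 95) where
  "t \<up> n \<equiv> rename (\<lambda>i. i + n) t"

definition up_sub :: "(nat \<Rightarrow> tm) \<Rightarrow> nat \<Rightarrow> tm" where
  "up_sub s = case_nat (Var 0) (\<lambda>i. s i \<up> 1)"

primrec subst :: "(nat \<Rightarrow> tm) \<Rightarrow> tm \<Rightarrow> tm" where
  "subst r (Var i) = r i"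
| "subst r (Univ l) = Univ l"
| "subst r (Pi A B) = Pi (subst r A) (subst (up_sub r) B)"
| "subst r (Lam t) = Lam (subst (up_sub r) t)"
| "subst r (App f a) = App (subst r f) (subst r a)"
| "subst r (Sig A B) = Sig (subst r A) (subst (up_sub r) B)"
| "subst r (Tup a b) = Tup (subst r a) (subst r b)"
| "subst r (Proj1 p) = Proj1 (subst r p)"
| "subst r (Proj2 p) = Proj2 (subst r p)"
| "subst r (Coprod A B) = Coprod (subst r A) (subst r B)"
| "subst r (InL a) = InL (subst r a)"
| "subst r (InR b) = InR (subst r b)"
| "subst r (CaseOf C s t u) =
     CaseOf (subst (up_sub r) C) (subst (up_sub r) s) (subst (up_sub r) t) (subst r u)"
| "subst r (Empty l) = Empty l"
| "subst r (Abort C e) = Abort (subst (up_sub r) C) (subst r e)"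
| "subst r (Unit l) = Unit l"
| "subst r (Star l) = Star l"
| "subst r (UnitRec C c u) = UnitRec (subst (up_sub r) C) (subst r c) (subst r u)"
| "subst r NatT = NatT"
| "subst r ZeroT = ZeroT"
| "subst r (SucT n) = SucT (subst r n)"
| "subst r (NatRec C z s n) =
     NatRec (subst (up_sub r) C) (subst r z) (subst (up_sub (up_sub r)) s) (subst r n)"
| "subst r (Eq A a b) = Eq (subst r A) (subst r a) (subst r b)"
| "subst r (Rfl a) = Rfl (subst r a)"
| "subst r (J A a C d b p) =
     J (subst r A) (subst r a) (subst (up_sub (up_sub r)) C) (subst r d) (subst r b) (subst r p)"
| "subst r (Trunc A) = Trunc (subst r A)"
| "subst r (TrIn a) = TrIn (subst r a)"
| "subst r (Squash s t) = Squash (subst r s) (subst r t)"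
| "subst r (TrRec P h f t) = TrRec (subst r P) (subst r h) (subst r f) (subst r t)"
| "subst r (Funext f g h) = Funext (subst r f) (subst r g) (subst r h)"
| "subst r (Propext P Q h k f g) =
     Propext (subst r P) (subst r Q) (subst r h) (subst r k) (subst r f) (subst r g)"

definition inst :: "tm \<Rightarrow> tm \<Rightarrow> tm" where
  "inst B a = subst (case_nat a Var) B"

text \<open>The variable 0 is replaced by the last argument.\<close>

definition inst2 :: "tm \<Rightarrow> tm \<Rightarrow> tm \<Rightarrow> tm" where
  "inst2 C b p = subst (case_nat p (case_nat b Var)) C"

text \<open>
  \<open>C\<close> lives over \<open>A\<close> (resp. the naturals); the result, over the extended context of a branch,
  is \<open>C\<close> at the constructor \<open>c\<close> applied to the branch variables, of which there are \<open>n\<close>.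
\<close>

definition inst_branch :: "tm \<Rightarrow> nat \<Rightarrow> tm \<Rightarrow> tm" where
  "inst_branch C n c = subst (case_nat c (\<lambda>i. Var (i + n))) C"

abbreviation arrow :: "tm \<Rightarrow> tm \<Rightarrow> tm"  (infixr "\<rightarrow>" 60) where
  "A \<rightarrow> B \<equiv> Pi A (B \<up> 1)"

abbreviation product :: "tm \<Rightarrow> tm \<Rightarrow> tm"  (infixr "\<otimes>" 70) where
  "A \<otimes> B \<equiv> Sig A (B \<up> 1)"

definition is_prop :: "tm \<Rightarrow> tm" where
  "is_prop A = Pi A (Pi (A \<up> 1) (Eq (A \<up> 2) (Var 1) (Var 0)))"

text \<open>
  Universes are Russell-style and not cumulative; every type is an element of a universe, so
  "\<open>A\<close> is a type" is \<open>\<Gamma> \<turnstile> A \<Colon> Univ i\<close> for some \<open>i\<close>. The most recent variable of a context comes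
  first. Empty and unit types are available in every universe. Truncation is not assumed to
  satisfy a judgemental computation rule.
\<close>

inductive wf :: "tm list \<Rightarrow> bool"
  and typing :: "tm list \<Rightarrow> tm \<Rightarrow> tm \<Rightarrow> bool"  ("_ \<turnstile> _ \<Colon> _" [51, 51, 51] 50)
  and eqtm :: "tm list \<Rightarrow> tm \<Rightarrow> tm \<Rightarrow> tm \<Rightarrow> bool"  ("_ \<turnstile> _ \<doteq> _ \<Colon> _" [51, 51, 51, 51] 50)
where
  wf_Nil: "wf []"
| wf_Cons: "\<lbrakk>wf \<Gamma>; \<Gamma> \<turnstile> A \<Colon> Univ i\<rbrakk> \<Longrightarrow> wf (A # \<Gamma>)"

| ty_Var: "\<lbrakk>wf \<Gamma>; i < length \<Gamma>\<rbrakk> \<Longrightarrow> \<Gamma> \<turnstile> Var i \<Colon> (\<Gamma> ! i) \<up> (Suc i)"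
| ty_conv: "\<lbrakk>\<Gamma> \<turnstile> t \<Colon> A; \<Gamma> \<turnstile> A \<doteq> B \<Colon> Univ i\<rbrakk> \<Longrightarrow> \<Gamma> \<turnstile> t \<Colon> B"
| ty_Univ: "wf \<Gamma> \<Longrightarrow> \<Gamma> \<turnstile> Univ i \<Colon> Univ (Suc i)"

| ty_Pi: "\<lbrakk>\<Gamma> \<turnstile> A \<Colon> Univ i; A # \<Gamma> \<turnstile> B \<Colon> Univ j\<rbrakk> \<Longrightarrow> \<Gamma> \<turnstile> Pi A B \<Colon> Univ (max i j)"
| ty_Lam: "\<lbrakk>\<Gamma> \<turnstile> A \<Colon> Univ i; A # \<Gamma> \<turnstile> t \<Colon> B\<rbrakk> \<Longrightarrow> \<Gamma> \<turnstile> Lam t \<Colon> Pi A B"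
| ty_App: "\<lbrakk>\<Gamma> \<turnstile> f \<Colon> Pi A B; \<Gamma> \<turnstile> a \<Colon> A\<rbrakk> \<Longrightarrow> \<Gamma> \<turnstile> f \<cdot> a \<Colon> inst B a"

| ty_Sig: "\<lbrakk>\<Gamma> \<turnstile> A \<Colon> Univ i; A # \<Gamma> \<turnstile> B \<Colon> Univ j\<rbrakk> \<Longrightarrow> \<Gamma> \<turnstile> Sig A B \<Colon> Univ (max i j)"
| ty_Tup: "\<lbrakk>\<Gamma> \<turnstile> A \<Colon> Univ i; A # \<Gamma> \<turnstile> B \<Colon> Univ j; \<Gamma> \<turnstile> a \<Colon> A; \<Gamma> \<turnstile> b \<Colon> inst B a\<rbrakk>
    \<Longrightarrow> \<Gamma> \<turnstile> Tup a b \<Colon> Sig A B"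
| ty_Proj1: "\<Gamma> \<turnstile> p \<Colon> Sig A B \<Longrightarrow> \<Gamma> \<turnstile> Proj1 p \<Colon> A"
| ty_Proj2: "\<Gamma> \<turnstile> p \<Colon> Sig A B \<Longrightarrow> \<Gamma> \<turnstile> Proj2 p \<Colon> inst B (Proj1 p)"

| ty_Coprod: "\<lbrakk>\<Gamma> \<turnstile> A \<Colon> Univ i; \<Gamma> \<turnstile> B \<Colon> Univ j\<rbrakk> \<Longrightarrow> \<Gamma> \<turnstile> Coprod A B \<Colon> Univ (max i j)"
| ty_InL: "\<lbrakk>\<Gamma> \<turnstile> a \<Colon> A; \<Gamma> \<turnstile> B \<Colon> Univ j\<rbrakk> \<Longrightarrow> \<Gamma> \<turnstile> InL a \<Colon> Coprod A B"
| ty_InR: "\<lbrakk>\<Gamma> \<turnstile> A \<Colon> Univ i; \<Gamma> \<turnstile> b \<Colon> B\<rbrakk> \<Longrightarrow> \<Gamma> \<turnstile> InR b \<Colon> Coprod A B"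
| ty_CaseOf: "\<lbrakk>Coprod A B # \<Gamma> \<turnstile> C \<Colon> Univ k;
      A # \<Gamma> \<turnstile> s \<Colon> inst_branch C 1 (InL (Var 0)); B # \<Gamma> \<turnstile> t \<Colon> inst_branch C 1 (InR (Var 0));
      \<Gamma> \<turnstile> u \<Colon> Coprod A B\<rbrakk>
    \<Longrightarrow> \<Gamma> \<turnstile> CaseOf C s t u \<Colon> inst C u"

| ty_Empty: "wf \<Gamma> \<Longrightarrow> \<Gamma> \<turnstile> Empty i \<Colon> Univ i"
| ty_Abort: "\<lbrakk>Empty i # \<Gamma> \<turnstile> C \<Colon> Univ k; \<Gamma> \<turnstile> e \<Colon> Empty i\<rbrakk> \<Longrightarrow> \<Gamma> \<turnstile> Abort C e \<Colon> inst C e"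

| ty_Unit: "wf \<Gamma> \<Longrightarrow> \<Gamma> \<turnstile> Unit i \<Colon> Univ i"
| ty_Star: "wf \<Gamma> \<Longrightarrow> \<Gamma> \<turnstile> Star i \<Colon> Unit i"
| ty_UnitRec: "\<lbrakk>Unit i # \<Gamma> \<turnstile> C \<Colon> Univ k; \<Gamma> \<turnstile> c \<Colon> inst C (Star i); \<Gamma> \<turnstile> u \<Colon> Unit i\<rbrakk>
    \<Longrightarrow> \<Gamma> \<turnstile> UnitRec C c u \<Colon> inst C u"

| ty_NatT: "wf \<Gamma> \<Longrightarrow> \<Gamma> \<turnstile> NatT \<Colon> Univ 0"
| ty_ZeroT: "wf \<Gamma> \<Longrightarrow> \<Gamma> \<turnstile> ZeroT \<Colon> NatT"
| ty_SucT: "\<Gamma> \<turnstile> n \<Colon> NatT \<Longrightarrow> \<Gamma> \<turnstile> SucT n \<Colon> NatT"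
| ty_NatRec: "\<lbrakk>NatT # \<Gamma> \<turnstile> C \<Colon> Univ k; \<Gamma> \<turnstile> z \<Colon> inst C ZeroT;
      C # NatT # \<Gamma> \<turnstile> s \<Colon> inst_branch C 2 (SucT (Var 1)); \<Gamma> \<turnstile> n \<Colon> NatT\<rbrakk>
    \<Longrightarrow> \<Gamma> \<turnstile> NatRec C z s n \<Colon> inst C n"

| ty_Eq: "\<lbrakk>\<Gamma> \<turnstile> A \<Colon> Univ i; \<Gamma> \<turnstile> a \<Colon> A; \<Gamma> \<turnstile> b \<Colon> A\<rbrakk> \<Longrightarrow> \<Gamma> \<turnstile> Eq A a b \<Colon> Univ i"
| ty_Rfl: "\<Gamma> \<turnstile> a \<Colon> A \<Longrightarrow> \<Gamma> \<turnstile> Rfl a \<Colon> Eq A a a"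
| ty_J: "\<lbrakk>\<Gamma> \<turnstile> a \<Colon> A; Eq (A \<up> 1) (a \<up> 1) (Var 0) # A # \<Gamma> \<turnstile> C \<Colon> Univ k;
      \<Gamma> \<turnstile> d \<Colon> inst2 C a (Rfl a); \<Gamma> \<turnstile> b \<Colon> A; \<Gamma> \<turnstile> p \<Colon> Eq A a b\<rbrakk>
    \<Longrightarrow> \<Gamma> \<turnstile> J A a C d b p \<Colon> inst2 C b p"

| ty_Trunc: "\<Gamma> \<turnstile> A \<Colon> Univ i \<Longrightarrow> \<Gamma> \<turnstile> Trunc A \<Colon> Univ i"
| ty_TrIn: "\<Gamma> \<turnstile> a \<Colon> A \<Longrightarrow> \<Gamma> \<turnstile> TrIn a \<Colon> Trunc A"
| ty_Squash: "\<lbrakk>\<Gamma> \<turnstile> s \<Colon> Trunc A; \<Gamma> \<turnstile> t \<Colon> Trunc A\<rbrakk> \<Longrightarrow> \<Gamma> \<turnstile> Squash s t \<Colon> Eq (Trunc A) s t"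
| ty_TrRec: "\<lbrakk>\<Gamma> \<turnstile> P \<Colon> Univ k; \<Gamma> \<turnstile> h \<Colon> is_prop P; \<Gamma> \<turnstile> f \<Colon> A \<rightarrow> P; \<Gamma> \<turnstile> t \<Colon> Trunc A\<rbrakk>
    \<Longrightarrow> \<Gamma> \<turnstile> TrRec P h f t \<Colon> P"

| ty_Funext: "\<lbrakk>\<Gamma> \<turnstile> f \<Colon> Pi A B; \<Gamma> \<turnstile> g \<Colon> Pi A B;
      \<Gamma> \<turnstile> h \<Colon> Pi A (Eq B (f \<up> 1 \<cdot> Var 0) (g \<up> 1 \<cdot> Var 0))\<rbrakk>
    \<Longrightarrow> \<Gamma> \<turnstile> Funext f g h \<Colon> Eq (Pi A B) f g"
| ty_Propext: "\<lbrakk>\<Gamma> \<turnstile> P \<Colon> Univ i; \<Gamma> \<turnstile> Q \<Colon> Univ i; \<Gamma> \<turnstile> h \<Colon> is_prop P; \<Gamma> \<turnstile> k \<Colon> is_prop Q;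
      \<Gamma> \<turnstile> f \<Colon> P \<rightarrow> Q; \<Gamma> \<turnstile> g \<Colon> Q \<rightarrow> P\<rbrakk>
    \<Longrightarrow> \<Gamma> \<turnstile> Propext P Q h k f g \<Colon> Eq (Univ i) P Q"

| eq_refl: "\<Gamma> \<turnstile> t \<Colon> A \<Longrightarrow> \<Gamma> \<turnstile> t \<doteq> t \<Colon> A"
| eq_sym: "\<Gamma> \<turnstile> t \<doteq> u \<Colon> A \<Longrightarrow> \<Gamma> \<turnstile> u \<doteq> t \<Colon> A"
| eq_trans: "\<lbrakk>\<Gamma> \<turnstile> t \<doteq> u \<Colon> A; \<Gamma> \<turnstile> u \<doteq> v \<Colon> A\<rbrakk> \<Longrightarrow> \<Gamma> \<turnstile> t \<doteq> v \<Colon> A"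
| eq_conv: "\<lbrakk>\<Gamma> \<turnstile> t \<doteq> u \<Colon> A; \<Gamma> \<turnstile> A \<doteq> B \<Colon> Univ i\<rbrakk> \<Longrightarrow> \<Gamma> \<turnstile> t \<doteq> u \<Colon> B"

| eq_Pi_beta: "\<lbrakk>\<Gamma> \<turnstile> A \<Colon> Univ i; A # \<Gamma> \<turnstile> t \<Colon> B; \<Gamma> \<turnstile> a \<Colon> A\<rbrakk>
    \<Longrightarrow> \<Gamma> \<turnstile> Lam t \<cdot> a \<doteq> inst t a \<Colon> inst B a"
| eq_Pi_eta: "\<Gamma> \<turnstile> f \<Colon> Pi A B \<Longrightarrow> \<Gamma> \<turnstile> f \<doteq> Lam (f \<up> 1 \<cdot> Var 0) \<Colon> Pi A B"
| eq_Sig_beta1: "\<lbrakk>\<Gamma> \<turnstile> A \<Colon> Univ i; A # \<Gamma> \<turnstile> B \<Colon> Univ j; \<Gamma> \<turnstile> a \<Colon> A; \<Gamma> \<turnstile> b \<Colon> inst B a\<rbrakk>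
    \<Longrightarrow> \<Gamma> \<turnstile> Proj1 (Tup a b) \<doteq> a \<Colon> A"
| eq_Sig_beta2: "\<lbrakk>\<Gamma> \<turnstile> A \<Colon> Univ i; A # \<Gamma> \<turnstile> B \<Colon> Univ j; \<Gamma> \<turnstile> a \<Colon> A; \<Gamma> \<turnstile> b \<Colon> inst B a\<rbrakk>
    \<Longrightarrow> \<Gamma> \<turnstile> Proj2 (Tup a b) \<doteq> b \<Colon> inst B a"
| eq_Sig_eta: "\<Gamma> \<turnstile> p \<Colon> Sig A B \<Longrightarrow> \<Gamma> \<turnstile> p \<doteq> Tup (Proj1 p) (Proj2 p) \<Colon> Sig A B"
| eq_Coprod_beta1: "\<lbrakk>Coprod A B # \<Gamma> \<turnstile> C \<Colon> Univ k;
      A # \<Gamma> \<turnstile> s \<Colon> inst_branch C 1 (InL (Var 0)); B # \<Gamma> \<turnstile> t \<Colon> inst_branch C 1 (InR (Var 0));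
      \<Gamma> \<turnstile> a \<Colon> A\<rbrakk>
    \<Longrightarrow> \<Gamma> \<turnstile> CaseOf C s t (InL a) \<doteq> inst s a \<Colon> inst C (InL a)"
| eq_Coprod_beta2: "\<lbrakk>Coprod A B # \<Gamma> \<turnstile> C \<Colon> Univ k;
      A # \<Gamma> \<turnstile> s \<Colon> inst_branch C 1 (InL (Var 0)); B # \<Gamma> \<turnstile> t \<Colon> inst_branch C 1 (InR (Var 0));
      \<Gamma> \<turnstile> b \<Colon> B\<rbrakk>
    \<Longrightarrow> \<Gamma> \<turnstile> CaseOf C s t (InR b) \<doteq> inst t b \<Colon> inst C (InR b)"
| eq_Unit_beta: "\<lbrakk>Unit i # \<Gamma> \<turnstile> C \<Colon> Univ k; \<Gamma> \<turnstile> c \<Colon> inst C (Star i)\<rbrakk>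
    \<Longrightarrow> \<Gamma> \<turnstile> UnitRec C c (Star i) \<doteq> c \<Colon> inst C (Star i)"
| eq_Nat_beta1: "\<lbrakk>NatT # \<Gamma> \<turnstile> C \<Colon> Univ k; \<Gamma> \<turnstile> z \<Colon> inst C ZeroT;
      C # NatT # \<Gamma> \<turnstile> s \<Colon> inst_branch C 2 (SucT (Var 1))\<rbrakk>
    \<Longrightarrow> \<Gamma> \<turnstile> NatRec C z s ZeroT \<doteq> z \<Colon> inst C ZeroT"
| eq_Nat_beta2: "\<lbrakk>NatT # \<Gamma> \<turnstile> C \<Colon> Univ k; \<Gamma> \<turnstile> z \<Colon> inst C ZeroT;
      C # NatT # \<Gamma> \<turnstile> s \<Colon> inst_branch C 2 (SucT (Var 1)); \<Gamma> \<turnstile> n \<Colon> NatT\<rbrakk>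
    \<Longrightarrow> \<Gamma> \<turnstile> NatRec C z s (SucT n) \<doteq> inst2 s n (NatRec C z s n) \<Colon> inst C (SucT n)"
| eq_J_beta: "\<lbrakk>\<Gamma> \<turnstile> a \<Colon> A; Eq (A \<up> 1) (a \<up> 1) (Var 0) # A # \<Gamma> \<turnstile> C \<Colon> Univ k;
      \<Gamma> \<turnstile> d \<Colon> inst2 C a (Rfl a)\<rbrakk>
    \<Longrightarrow> \<Gamma> \<turnstile> J A a C d a (Rfl a) \<doteq> d \<Colon> inst2 C a (Rfl a)"

| cong_Pi: "\<lbrakk>\<Gamma> \<turnstile> A \<Colon> Univ i; \<Gamma> \<turnstile> A \<doteq> A' \<Colon> Univ i; A # \<Gamma> \<turnstile> B \<doteq> B' \<Colon> Univ j\<rbrakk>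
    \<Longrightarrow> \<Gamma> \<turnstile> Pi A B \<doteq> Pi A' B' \<Colon> Univ (max i j)"
| cong_Lam: "\<lbrakk>\<Gamma> \<turnstile> A \<Colon> Univ i; A # \<Gamma> \<turnstile> t \<doteq> t' \<Colon> B\<rbrakk> \<Longrightarrow> \<Gamma> \<turnstile> Lam t \<doteq> Lam t' \<Colon> Pi A B"
| cong_App: "\<lbrakk>\<Gamma> \<turnstile> f \<doteq> f' \<Colon> Pi A B; \<Gamma> \<turnstile> a \<doteq> a' \<Colon> A\<rbrakk> \<Longrightarrow> \<Gamma> \<turnstile> f \<cdot> a \<doteq> f' \<cdot> a' \<Colon> inst B a"
| cong_Sig: "\<lbrakk>\<Gamma> \<turnstile> A \<Colon> Univ i; \<Gamma> \<turnstile> A \<doteq> A' \<Colon> Univ i; A # \<Gamma> \<turnstile> B \<doteq> B' \<Colon> Univ j\<rbrakk>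
    \<Longrightarrow> \<Gamma> \<turnstile> Sig A B \<doteq> Sig A' B' \<Colon> Univ (max i j)"
| cong_Tup: "\<lbrakk>\<Gamma> \<turnstile> A \<Colon> Univ i; A # \<Gamma> \<turnstile> B \<Colon> Univ j; \<Gamma> \<turnstile> a \<doteq> a' \<Colon> A; \<Gamma> \<turnstile> b \<doteq> b' \<Colon> inst B a\<rbrakk>
    \<Longrightarrow> \<Gamma> \<turnstile> Tup a b \<doteq> Tup a' b' \<Colon> Sig A B"
| cong_Proj1: "\<Gamma> \<turnstile> p \<doteq> p' \<Colon> Sig A B \<Longrightarrow> \<Gamma> \<turnstile> Proj1 p \<doteq> Proj1 p' \<Colon> A"
| cong_Proj2: "\<Gamma> \<turnstile> p \<doteq> p' \<Colon> Sig A B \<Longrightarrow> \<Gamma> \<turnstile> Proj2 p \<doteq> Proj2 p' \<Colon> inst B (Proj1 p)"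
| cong_Coprod: "\<lbrakk>\<Gamma> \<turnstile> A \<doteq> A' \<Colon> Univ i; \<Gamma> \<turnstile> B \<doteq> B' \<Colon> Univ j\<rbrakk>
    \<Longrightarrow> \<Gamma> \<turnstile> Coprod A B \<doteq> Coprod A' B' \<Colon> Univ (max i j)"
| cong_InL: "\<lbrakk>\<Gamma> \<turnstile> a \<doteq> a' \<Colon> A; \<Gamma> \<turnstile> B \<Colon> Univ j\<rbrakk> \<Longrightarrow> \<Gamma> \<turnstile> InL a \<doteq> InL a' \<Colon> Coprod A B"
| cong_InR: "\<lbrakk>\<Gamma> \<turnstile> A \<Colon> Univ i; \<Gamma> \<turnstile> b \<doteq> b' \<Colon> B\<rbrakk> \<Longrightarrow> \<Gamma> \<turnstile> InR b \<doteq> InR b' \<Colon> Coprod A B"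
| cong_CaseOf: "\<lbrakk>Coprod A B # \<Gamma> \<turnstile> C \<doteq> C' \<Colon> Univ k;
      A # \<Gamma> \<turnstile> s \<doteq> s' \<Colon> inst_branch C 1 (InL (Var 0));
      B # \<Gamma> \<turnstile> t \<doteq> t' \<Colon> inst_branch C 1 (InR (Var 0));
      \<Gamma> \<turnstile> u \<doteq> u' \<Colon> Coprod A B\<rbrakk>
    \<Longrightarrow> \<Gamma> \<turnstile> CaseOf C s t u \<doteq> CaseOf C' s' t' u' \<Colon> inst C u"
| cong_Abort: "\<lbrakk>Empty i # \<Gamma> \<turnstile> C \<doteq> C' \<Colon> Univ k; \<Gamma> \<turnstile> e \<doteq> e' \<Colon> Empty i\<rbrakk>
    \<Longrightarrow> \<Gamma> \<turnstile> Abort C e \<doteq> Abort C' e' \<Colon> inst C e"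
| cong_UnitRec: "\<lbrakk>Unit i # \<Gamma> \<turnstile> C \<doteq> C' \<Colon> Univ k; \<Gamma> \<turnstile> c \<doteq> c' \<Colon> inst C (Star i);
      \<Gamma> \<turnstile> u \<doteq> u' \<Colon> Unit i\<rbrakk>
    \<Longrightarrow> \<Gamma> \<turnstile> UnitRec C c u \<doteq> UnitRec C' c' u' \<Colon> inst C u"
| cong_SucT: "\<Gamma> \<turnstile> n \<doteq> n' \<Colon> NatT \<Longrightarrow> \<Gamma> \<turnstile> SucT n \<doteq> SucT n' \<Colon> NatT"
| cong_NatRec: "\<lbrakk>NatT # \<Gamma> \<turnstile> C \<Colon> Univ k; NatT # \<Gamma> \<turnstile> C \<doteq> C' \<Colon> Univ k;
      \<Gamma> \<turnstile> z \<doteq> z' \<Colon> inst C ZeroT; C # NatT # \<Gamma> \<turnstile> s \<doteq> s' \<Colon> inst_branch C 2 (SucT (Var 1));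
      \<Gamma> \<turnstile> n \<doteq> n' \<Colon> NatT\<rbrakk>
    \<Longrightarrow> \<Gamma> \<turnstile> NatRec C z s n \<doteq> NatRec C' z' s' n' \<Colon> inst C n"
| cong_Eq: "\<lbrakk>\<Gamma> \<turnstile> A \<doteq> A' \<Colon> Univ i; \<Gamma> \<turnstile> a \<doteq> a' \<Colon> A; \<Gamma> \<turnstile> b \<doteq> b' \<Colon> A\<rbrakk>
    \<Longrightarrow> \<Gamma> \<turnstile> Eq A a b \<doteq> Eq A' a' b' \<Colon> Univ i"
| cong_Rfl: "\<Gamma> \<turnstile> a \<doteq> a' \<Colon> A \<Longrightarrow> \<Gamma> \<turnstile> Rfl a \<doteq> Rfl a' \<Colon> Eq A a a"
| cong_J: "\<lbrakk>\<Gamma> \<turnstile> A \<doteq> A' \<Colon> Univ i; \<Gamma> \<turnstile> a \<Colon> A; \<Gamma> \<turnstile> a \<doteq> a' \<Colon> A;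
      Eq (A \<up> 1) (a \<up> 1) (Var 0) # A # \<Gamma> \<turnstile> C \<doteq> C' \<Colon> Univ k;
      \<Gamma> \<turnstile> d \<doteq> d' \<Colon> inst2 C a (Rfl a); \<Gamma> \<turnstile> b \<doteq> b' \<Colon> A; \<Gamma> \<turnstile> p \<doteq> p' \<Colon> Eq A a b\<rbrakk>
    \<Longrightarrow> \<Gamma> \<turnstile> J A a C d b p \<doteq> J A' a' C' d' b' p' \<Colon> inst2 C b p"
| cong_Trunc: "\<Gamma> \<turnstile> A \<doteq> A' \<Colon> Univ i \<Longrightarrow> \<Gamma> \<turnstile> Trunc A \<doteq> Trunc A' \<Colon> Univ i"
| cong_TrIn: "\<Gamma> \<turnstile> a \<doteq> a' \<Colon> A \<Longrightarrow> \<Gamma> \<turnstile> TrIn a \<doteq> TrIn a' \<Colon> Trunc A"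
| cong_Squash: "\<lbrakk>\<Gamma> \<turnstile> s \<doteq> s' \<Colon> Trunc A; \<Gamma> \<turnstile> t \<doteq> t' \<Colon> Trunc A\<rbrakk>
    \<Longrightarrow> \<Gamma> \<turnstile> Squash s t \<doteq> Squash s' t' \<Colon> Eq (Trunc A) s t"
| cong_TrRec: "\<lbrakk>\<Gamma> \<turnstile> P \<doteq> P' \<Colon> Univ k; \<Gamma> \<turnstile> h \<doteq> h' \<Colon> is_prop P; \<Gamma> \<turnstile> f \<doteq> f' \<Colon> A \<rightarrow> P;
      \<Gamma> \<turnstile> t \<doteq> t' \<Colon> Trunc A\<rbrakk>
    \<Longrightarrow> \<Gamma> \<turnstile> TrRec P h f t \<doteq> TrRec P' h' f' t' \<Colon> P"
| cong_Funext: "\<lbrakk>\<Gamma> \<turnstile> f \<doteq> f' \<Colon> Pi A B; \<Gamma> \<turnstile> g \<doteq> g' \<Colon> Pi A B;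
      \<Gamma> \<turnstile> h \<doteq> h' \<Colon> Pi A (Eq B (f \<up> 1 \<cdot> Var 0) (g \<up> 1 \<cdot> Var 0))\<rbrakk>
    \<Longrightarrow> \<Gamma> \<turnstile> Funext f g h \<doteq> Funext f' g' h' \<Colon> Eq (Pi A B) f g"
| cong_Propext: "\<lbrakk>\<Gamma> \<turnstile> P \<doteq> P' \<Colon> Univ i; \<Gamma> \<turnstile> Q \<doteq> Q' \<Colon> Univ i; \<Gamma> \<turnstile> h \<doteq> h' \<Colon> is_prop P;
      \<Gamma> \<turnstile> k \<doteq> k' \<Colon> is_prop Q; \<Gamma> \<turnstile> f \<doteq> f' \<Colon> P \<rightarrow> Q; \<Gamma> \<turnstile> g \<doteq> g' \<Colon> Q \<rightarrow> P\<rbrakk>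
    \<Longrightarrow> \<Gamma> \<turnstile> Propext P Q h k f g \<doteq> Propext P' Q' h' k' f' g' \<Colon> Eq (Univ i) P Q"


section \<open>Posets and excluded middle in the type theory\<close>

text \<open>
  Each definition is a type (or term) in the context of its arguments, which are therefore
  weakened under binders. Order relations \<open>R\<close> are terms of type \<open>X \<rightarrow> X \<rightarrow> Univ t\<close>. The comments give the intended formula with named variables.
\<close>

definition neg :: "tm \<Rightarrow> tm" where
  "neg A = (A \<rightarrow> Empty 0)"

(* maps with a left and a right inverse: Sigma f : A -> B.
     (Sigma g : B -> A. Pi x : A. g (f x) = x) * (Sigma g : B -> A. Pi y : B. f (g y) = y) *)
definition equivalence :: "tm \<Rightarrow> tm \<Rightarrow> tm" where
  "equivalence A B = Sig (A \<rightarrow> B)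
     (Sig (B \<up> 1 \<rightarrow> A \<up> 1) (Pi (A \<up> 2) (Eq (A \<up> 3) (Var 1 \<cdot> (Var 2 \<cdot> Var 0)) (Var 0))) \<otimes>
      Sig (B \<up> 1 \<rightarrow> A \<up> 1) (Pi (B \<up> 2) (Eq (B \<up> 3) (Var 2 \<cdot> (Var 1 \<cdot> Var 0)) (Var 0))))"

abbreviation rel :: "tm \<Rightarrow> tm \<Rightarrow> tm \<Rightarrow> tm" where
  "rel R x y \<equiv> R \<cdot> x \<cdot> y"

definition reflexive :: "tm \<Rightarrow> tm \<Rightarrow> tm" where
  "reflexive X R = Pi X (rel (R \<up> 1) (Var 0) (Var 0))"

(* Pi x y z : X. R x y -> R y z -> R x z *)
definition transitive :: "tm \<Rightarrow> tm \<Rightarrow> tm" where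
  "transitive X R = Pi X (Pi (X \<up> 1) (Pi (X \<up> 2)
     (rel (R \<up> 3) (Var 2) (Var 1) \<rightarrow> rel (R \<up> 3) (Var 1) (Var 0) \<rightarrow> rel (R \<up> 3) (Var 2) (Var 0))))"

(* Pi x y : X. R x y -> R y x -> x = y *)
definition antisymmetric :: "tm \<Rightarrow> tm \<Rightarrow> tm" where
  "antisymmetric X R = Pi X (Pi (X \<up> 1)
     (rel (R \<up> 2) (Var 1) (Var 0) \<rightarrow> rel (R \<up> 2) (Var 0) (Var 1) \<rightarrow> Eq (X \<up> 2) (Var 1) (Var 0)))"

definition prop_valued :: "tm \<Rightarrow> tm \<Rightarrow> tm" where
  "prop_valued X R = Pi X (Pi (X \<up> 1) (is_prop (rel (R \<up> 2) (Var 1) (Var 0))))"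

definition poset_axioms :: "tm \<Rightarrow> tm \<Rightarrow> tm" where
  "poset_axioms X R = prop_valued X R \<otimes> reflexive X R \<otimes> transitive X R \<otimes> antisymmetric X R"

definition poset_trans :: "tm \<Rightarrow> tm" where
  "poset_trans ax = Proj1 (Proj2 (Proj2 ax))"

(* (Pi i : I. R (f i) s) * (Pi b : X. (Pi i : I. R (f i) b) -> R s b) *)
definition is_sup :: "tm \<Rightarrow> tm \<Rightarrow> tm \<Rightarrow> tm \<Rightarrow> tm \<Rightarrow> tm" where
  "is_sup X R I f s =
     Pi I (rel (R \<up> 1) (f \<up> 1 \<cdot> Var 0) (s \<up> 1)) \<otimes>
     Pi X (Pi (I \<up> 1) (rel (R \<up> 2) (f \<up> 2 \<cdot> Var 0) (Var 1)) \<rightarrow> rel (R \<up> 1) (s \<up> 1) (Var 0))"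

definition has_sup :: "tm \<Rightarrow> tm \<Rightarrow> tm \<Rightarrow> tm \<Rightarrow> tm" where
  "has_sup X R I f = Sig X (is_sup (X \<up> 1) (R \<up> 1) (I \<up> 1) (f \<up> 1) (Var 0))"

definition delta_index :: "nat \<Rightarrow> tm \<Rightarrow> tm" where
  "delta_index v P = Coprod (Unit v) P"

(* inl * |-> x, inr p |-> y; the function does not mention P, only its domain does *)
definition delta :: "tm \<Rightarrow> tm \<Rightarrow> tm \<Rightarrow> tm" where
  "delta X x y = Lam (CaseOf (X \<up> 2) (x \<up> 2) (y \<up> 2) (Var 0))"

(* Pi x y : X. R x y -> Pi P : Univ v. is_prop P -> has_sup (delta x y P);
   the bound variables are x = 3, y = 2, l : R x y = 1, P = 0 *)
definition delta_complete :: "nat \<Rightarrow> tm \<Rightarrow> tm \<Rightarrow> tm" where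
  "delta_complete v X R = Pi X (Pi (X \<up> 1) (Pi (rel (R \<up> 2) (Var 1) (Var 0)) (Pi (Univ v)
     (is_prop (Var 0) \<rightarrow>
        has_sup (X \<up> 4) (R \<up> 4) (delta_index v (Var 0)) (delta (X \<up> 4) (Var 3) (Var 2))))))"

(* the supremum of delta x y P, where c : delta_complete, l : R x y and h : is_prop P *)
definition delta_sup :: "tm \<Rightarrow> tm \<Rightarrow> tm \<Rightarrow> tm \<Rightarrow> tm \<Rightarrow> tm \<Rightarrow> tm" where
  "delta_sup c x y l P h = Proj1 (c \<cdot> x \<cdot> y \<cdot> l \<cdot> P \<cdot> h)"

(* Sigma l : R x y. Pi z : X. Pi m : R y z. Pi P : Univ v. Pi h : is_prop P.
     z = delta_sup x z P -> P, where R x z holds by transitivity;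
   the bound variables are l = 4, z = 3, m = 2, P = 1, h = 0 *)
definition strictly_below :: "nat \<Rightarrow> tm \<Rightarrow> tm \<Rightarrow> tm \<Rightarrow> tm \<Rightarrow> tm \<Rightarrow> tm \<Rightarrow> tm" where
  "strictly_below v X R ax c x y = Sig (rel R x y)
     (Pi (X \<up> 1) (Pi (rel (R \<up> 2) (y \<up> 2) (Var 0)) (Pi (Univ v) (Pi (is_prop (Var 0))
       (Eq (X \<up> 5) (Var 3)
          (delta_sup (c \<up> 5) (x \<up> 5) (Var 3)
             (poset_trans (ax \<up> 5) \<cdot> (x \<up> 5) \<cdot> (y \<up> 5) \<cdot> Var 3 \<cdot> Var 4 \<cdot> Var 2) (Var 1) (Var 0))
        \<rightarrow> Var 1)))))"

definition positive :: "nat \<Rightarrow> tm \<Rightarrow> tm \<Rightarrow> tm \<Rightarrow> tm \<Rightarrow> tm" where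
  "positive v X R ax c = Sig X (Sig (X \<up> 1)
     (strictly_below v (X \<up> 2) (R \<up> 2) (ax \<up> 2) (c \<up> 2) (Var 1) (Var 0)))"

(* Sigma S : X -> X -> Univ v. Pi x y : X. equivalence (R x y) (S x y) *)
definition locally_small :: "nat \<Rightarrow> tm \<Rightarrow> tm \<Rightarrow> tm" where
  "locally_small v X R = Sig (X \<rightarrow> X \<rightarrow> Univ v) (Pi (X \<up> 1) (Pi (X \<up> 2)
     (equivalence (rel (R \<up> 3) (Var 1) (Var 0)) (rel (Var 2) (Var 1) (Var 0)))))"

definition stable_equality :: "tm \<Rightarrow> tm" where
  "stable_equality X = Pi X (Pi (X \<up> 1)
     (neg (neg (Eq (X \<up> 2) (Var 1) (Var 0))) \<rightarrow> Eq (X \<up> 2) (Var 1) (Var 0)))"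

definition decidable_equality :: "tm \<Rightarrow> tm" where
  "decidable_equality X = Pi X (Pi (X \<up> 1)
     (Coprod (Eq (X \<up> 2) (Var 1) (Var 0)) (neg (Eq (X \<up> 2) (Var 1) (Var 0)))))"

text \<open>
  The type of positive locally small \<open>\<delta>\<close>-complete posets, for the universe \<open>v\<close>, with carrier in
  the universe \<open>u\<close>, order relation valued in the universe \<open>t\<close>, and equality satisfying \<open>E\<close>.
  The components are the carrier (3 in the last one), the order (2), the poset axioms (1) and
  the completeness (0).
\<close>

definition positive_poset :: "(tm \<Rightarrow> tm) \<Rightarrow> nat \<Rightarrow> nat \<Rightarrow> nat \<Rightarrow> tm" where
  "positive_poset E v u t =
     Sig (Univ u) (Sig (Var 0 \<rightarrow> Var 0 \<rightarrow> Univ t)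
       (Sig (poset_axioms (Var 1) (Var 0)) (Sig (delta_complete v (Var 2) (Var 1))
         (positive v (Var 3) (Var 2) (Var 1) (Var 0) \<otimes>
          locally_small v (Var 3) (Var 2) \<otimes> E (Var 3)))))"

definition excluded_middle :: "nat \<Rightarrow> tm" where
  "excluded_middle v = Pi (Univ v) (is_prop (Var 0) \<rightarrow> Trunc (Coprod (Var 0) (neg (Var 0))))"

text \<open>
  An assertion of the form "there is a structure, in some universes" quantifies over universe
  levels, which is not possible inside the type theory. It is represented by the set of closed
  types, one for each choice of levels, of which one is claimed to be inhabited. One such
  assertion implies another if the type theory has, for every member of the first, a closed
  function from it to some member of the second.
\<close>

definition entails :: "tm set \<Rightarrow> tm set \<Rightarrow> bool" where
  "entails \<A> \<B> \<longleftrightarrow> (\<forall>A\<in>\<A>. \<exists>B\<in>\<B>. \<exists>f. [] \<turnstile> f \<Colon> A \<rightarrow> B)"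

definition equivalent :: "tm set \<Rightarrow> tm set \<Rightarrow> bool" where
  "equivalent \<A> \<B> \<longleftrightarrow> entails \<A> \<B> \<and> entails \<B> \<A>"

definition stable_poset_exists :: "nat \<Rightarrow> tm set" where
  "stable_poset_exists v = {positive_poset stable_equality v u t | u t. True}"

definition decidable_poset_exists :: "nat \<Rightarrow> tm set" where
  "decidable_poset_exists v = {positive_poset decidable_equality v u t | u t. True}"

end

(*
  The idea. (i) implies (iii): let x be strictly below y, let Q be a proposition, and let P be the
  truncation of Q + not Q, which is not false. If P holds, then y is the supremum s of delta x y P;
  hence not not (y = s), so y = s by stability, and strictness yields P. (iii) implies (ii): given
  excluded middle, every poset is delta-complete, since the supremum of delta x y P is y if P holds
  and x if not, and x is strictly below y as soon as x <= y and not y <= x. The two-element poset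
  0 < 1 has decidable equality. (ii) implies (i) is immediate.

  Each implication is a closed term of the type theory. That it has the asserted type is computed by
  a type checker that is proved sound.
*)
theory Submission
  imports Defs "HOL-Library.Monad_Syntax"
begin


section \<open>A sound type checker\<close>

text \<open>Taking for P the truncated disjunction itself makes it a proposition by
  \<open>Squash\<close> and makes the output of strictness literally the conclusion of
  \<open>excluded_middle\<close>. Conversely, a supremum is an element to be chosen, whereas
  excluded middle only gives a truncated disjunction; so it is first turned into an actual decision.

  The formal obstacle is the metatheory. In place of presuppositions, the checker verifies the
  formation of types afresh; in place of weakening, closed terms are checked in an arbitrary
  context. A second obstacle is a circularity: typing asks for conversion, and a conversion is only
  sound for reducts that have been typed. A tower of judges, the lowest of which accepts nothing,
  cuts it, and two levels above the lowest suffice for the terms below. Universe levels remain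
  variables, which is why the checker is run by rewriting on terms with symbolic levels.\<close>

fun level_of :: "tm \<Rightarrow> nat option" where
  "level_of (Univ i) = Some i" | "level_of _ = None"

fun pi_of :: "tm \<Rightarrow> (tm \<times> tm) option" where
  "pi_of (Pi A B) = Some (A, B)" | "pi_of _ = None"

fun sig_of :: "tm \<Rightarrow> (tm \<times> tm) option" where
  "sig_of (Sig A B) = Some (A, B)" | "sig_of _ = None"

fun coprod_of :: "tm \<Rightarrow> (tm \<times> tm) option" where
  "coprod_of (Coprod A B) = Some (A, B)" | "coprod_of _ = None"

fun eq_of :: "tm \<Rightarrow> (tm \<times> tm \<times> tm) option" where
  "eq_of (Eq A a b) = Some (A, a, b)" | "eq_of _ = None"

fun trunc_of :: "tm \<Rightarrow> tm option" where
  "trunc_of (Trunc A) = Some A" | "trunc_of _ = None"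

fun empty_of :: "tm \<Rightarrow> nat option" where
  "empty_of (Empty i) = Some i" | "empty_of _ = None"

fun unit_of :: "tm \<Rightarrow> nat option" where
  "unit_of (Unit i) = Some i" | "unit_of _ = None"

fun lam_of :: "tm \<Rightarrow> tm option" where
  "lam_of (Lam t) = Some t" | "lam_of _ = None"

lemma dest_Some [simp]:
  "level_of T = Some i \<longleftrightarrow> T = Univ i"
  "pi_of T = Some p \<longleftrightarrow> T = Pi (fst p) (snd p)"
  "sig_of T = Some p \<longleftrightarrow> T = Sig (fst p) (snd p)"
  "coprod_of T = Some p \<longleftrightarrow> T = Coprod (fst p) (snd p)"
  "eq_of T = Some q \<longleftrightarrow> T = Eq (fst q) (fst (snd q)) (snd (snd q))"
  "trunc_of T = Some A \<longleftrightarrow> T = Trunc A"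
  "empty_of T = Some i \<longleftrightarrow> T = Empty i"
  "unit_of T = Some i \<longleftrightarrow> T = Unit i"
  "lam_of T = Some t \<longleftrightarrow> T = Lam t"
  by (cases T; auto)+

section \<open>Bidirectional type checking relative to a judge\<close>

datatype mode = Synth | Check tm | Dom tm

type_synonym judge = "(tm list \<Rightarrow> tm \<Rightarrow> bool) \<times> (tm list \<Rightarrow> tm \<Rightarrow> tm \<Rightarrow> bool)"

text \<open>At \<open>layer 0\<close> no conversion is accepted, so there the syntactic test alone
  lets a synthesized type match an expected one.\<close>

definition accept :: "judge \<Rightarrow> mode \<Rightarrow> tm list \<Rightarrow> tm option \<Rightarrow> tm option" where
  "accept K m \<Gamma> r = (case m of
     Check U \<Rightarrow> do {T \<leftarrow> r; if T = U then Some U else if snd K \<Gamma> T U then Some U else None}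
   | _ \<Rightarrow> r)"

abbreviation assert :: "bool \<Rightarrow> unit option" where
  "assert b \<equiv> (if b then Some () else None)"

text \<open>
  \<open>Check U\<close> and \<open>Synth\<close> are the two directions of bidirectional type checking. As \<open>Lam\<close>
  carries no domain, a redex \<open>Lam b \<cdot> a\<close> is typed by synthesizing the type of \<open>a\<close> first and
  passing it on in \<open>Dom\<close>. Whether a type that is not a subterm is well-formed (\<open>fst K\<close>), and
  whether two types are convertible (\<open>snd K\<close>), is left to a judge \<open>K\<close>, so that \<open>run\<close> is
  primitive recursive. Injections are synthesized with \<open>Unit 0\<close> as the unknown summand, which
  loses nothing in the redexes met below.
\<close>

primrec run :: "judge \<Rightarrow> mode \<Rightarrow> tm list \<Rightarrow> tm \<Rightarrow> tm option" where
  "run K m \<Gamma> (Var i) = accept K m \<Gamma> (if i < length \<Gamma> then Some ((\<Gamma> ! i) \<up> (Suc i)) else None)"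
| "run K m \<Gamma> (Univ l) = accept K m \<Gamma> (Some (Univ (Suc l)))"
| "run K m \<Gamma> (Pi A B) = accept K m \<Gamma> (do {
     i \<leftarrow> run K Synth \<Gamma> A \<bind> level_of;
     j \<leftarrow> run K Synth (A # \<Gamma>) B \<bind> level_of;
     Some (Univ (max i j))})"
| "run K m \<Gamma> (Lam t) = (case m of
     Synth \<Rightarrow> None
   | Check U \<Rightarrow> do {
       (A, B) \<leftarrow> pi_of U;
       assert (fst K \<Gamma> A);
       run K (Check B) (A # \<Gamma>) t;
       Some U}
   | Dom A \<Rightarrow> do {B \<leftarrow> run K Synth (A # \<Gamma>) t; Some (Pi A B)})"
| "run K m \<Gamma> (App f a) = accept K m \<Gamma> (if Option.is_none (lam_of f)
     then do {
       (A, B) \<leftarrow> run K Synth \<Gamma> f \<bind> pi_of;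
       run K (Check A) \<Gamma> a;
       Some (inst B a)}
     else do {
       A \<leftarrow> run K Synth \<Gamma> a;
       assert (fst K \<Gamma> A);
       (A', B) \<leftarrow> run K (Dom A) \<Gamma> f \<bind> pi_of;
       assert (A' = A);
       Some (inst B a)})"
| "run K m \<Gamma> (Sig A B) = accept K m \<Gamma> (do {
     i \<leftarrow> run K Synth \<Gamma> A \<bind> level_of;
     j \<leftarrow> run K Synth (A # \<Gamma>) B \<bind> level_of;
     Some (Univ (max i j))})"
| "run K m \<Gamma> (Tup a b) = (case m of
     Check U \<Rightarrow> do {
       (A, B) \<leftarrow> sig_of U;
       assert (fst K \<Gamma> A);
       assert (fst K (A # \<Gamma>) B);
       run K (Check A) \<Gamma> a;
       run K (Check (inst B a)) \<Gamma> b;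
       Some U}
   | _ \<Rightarrow> None)"
| "run K m \<Gamma> (Proj1 p) = accept K m \<Gamma> (do {
     (A, B) \<leftarrow> run K Synth \<Gamma> p \<bind> sig_of;
     Some A})"
| "run K m \<Gamma> (Proj2 p) = accept K m \<Gamma> (do {
     (A, B) \<leftarrow> run K Synth \<Gamma> p \<bind> sig_of;
     Some (inst B (Proj1 p))})"
| "run K m \<Gamma> (Coprod A B) = accept K m \<Gamma> (do {
     i \<leftarrow> run K Synth \<Gamma> A \<bind> level_of;
     j \<leftarrow> run K Synth \<Gamma> B \<bind> level_of;
     Some (Univ (max i j))})"
| "run K m \<Gamma> (InL a) = (case m of
     Check U \<Rightarrow> do {
       (A, B) \<leftarrow> coprod_of U;
       assert (fst K \<Gamma> B);
       run K (Check A) \<Gamma> a;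
       Some U}
   | _ \<Rightarrow> do {A \<leftarrow> run K Synth \<Gamma> a; Some (Coprod A (Unit 0))})"
| "run K m \<Gamma> (InR b) = (case m of
     Check U \<Rightarrow> do {
       (A, B) \<leftarrow> coprod_of U;
       assert (fst K \<Gamma> A);
       run K (Check B) \<Gamma> b;
       Some U}
   | _ \<Rightarrow> do {B \<leftarrow> run K Synth \<Gamma> b; Some (Coprod (Unit 0) B)})"
| "run K m \<Gamma> (CaseOf C s t u) = accept K m \<Gamma> (do {
     (A, B) \<leftarrow> run K Synth \<Gamma> u \<bind> coprod_of;
     assert (fst K \<Gamma> A);
     assert (fst K \<Gamma> B);
     k \<leftarrow> run K Synth (Coprod A B # \<Gamma>) C \<bind> level_of;
     run K (Check (inst_branch C 1 (InL (Var 0)))) (A # \<Gamma>) s;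
     run K (Check (inst_branch C 1 (InR (Var 0)))) (B # \<Gamma>) t;
     Some (inst C u)})"
| "run K m \<Gamma> (Empty l) = accept K m \<Gamma> (Some (Univ l))"
| "run K m \<Gamma> (Abort C e) = accept K m \<Gamma> (do {
     i \<leftarrow> run K Synth \<Gamma> e \<bind> empty_of;
     k \<leftarrow> run K Synth (Empty i # \<Gamma>) C \<bind> level_of;
     Some (inst C e)})"
| "run K m \<Gamma> (Unit l) = accept K m \<Gamma> (Some (Univ l))"
| "run K m \<Gamma> (Star l) = accept K m \<Gamma> (Some (Unit l))"
| "run K m \<Gamma> (UnitRec C c u) = accept K m \<Gamma> (do {
     i \<leftarrow> run K Synth \<Gamma> u \<bind> unit_of;
     k \<leftarrow> run K Synth (Unit i # \<Gamma>) C \<bind> level_of;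
     run K (Check (inst C (Star i))) \<Gamma> c;
     Some (inst C u)})"
| "run K m \<Gamma> NatT = None"
| "run K m \<Gamma> ZeroT = None"
| "run K m \<Gamma> (SucT n) = None"
| "run K m \<Gamma> (NatRec C z s n) = None"
| "run K m \<Gamma> (Eq A a b) = accept K m \<Gamma> (do {
     i \<leftarrow> run K Synth \<Gamma> A \<bind> level_of;
     run K (Check A) \<Gamma> a;
     run K (Check A) \<Gamma> b;
     Some (Univ i)})"
| "run K m \<Gamma> (Rfl a) = (case m of
     Check U \<Rightarrow> do {
       (A, b, c) \<leftarrow> eq_of U;
       if b = a \<and> c = a then do {run K (Check A) \<Gamma> a; Some U}
       else do {
         A \<leftarrow> run K Synth \<Gamma> a;
         assert (snd K \<Gamma> (Eq A a a) U);
         Some U}}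
   | _ \<Rightarrow> do {A \<leftarrow> run K Synth \<Gamma> a; Some (Eq A a a)})"
| "run K m \<Gamma> (J A a C d b p) = accept K m \<Gamma> (do {
     i \<leftarrow> run K Synth \<Gamma> A \<bind> level_of;
     assert (fst K (A # \<Gamma>) (Eq (A \<up> 1) (a \<up> 1) (Var 0)));
     run K (Check A) \<Gamma> a;
     k \<leftarrow> run K Synth (Eq (A \<up> 1) (a \<up> 1) (Var 0) # A # \<Gamma>) C \<bind> level_of;
     run K (Check (inst2 C a (Rfl a))) \<Gamma> d;
     run K (Check A) \<Gamma> b;
     run K (Check (Eq A a b)) \<Gamma> p;
     Some (inst2 C b p)})"
| "run K m \<Gamma> (Trunc A) = accept K m \<Gamma> (do {
     i \<leftarrow> run K Synth \<Gamma> A \<bind> level_of;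
     Some (Univ i)})"
| "run K m \<Gamma> (TrIn a) = (case m of
     Check U \<Rightarrow> do {
       A \<leftarrow> trunc_of U;
       run K (Check A) \<Gamma> a;
       Some U}
   | _ \<Rightarrow> None)"
| "run K m \<Gamma> (Squash s t) = accept K m \<Gamma> (do {
     A \<leftarrow> run K Synth \<Gamma> s \<bind> trunc_of;
     run K (Check (Trunc A)) \<Gamma> t;
     Some (Eq (Trunc A) s t)})"
| "run K m \<Gamma> (TrRec P h f t) = accept K m \<Gamma> (do {
     k \<leftarrow> run K Synth \<Gamma> P \<bind> level_of;
     run K (Check (is_prop P)) \<Gamma> h;
     A \<leftarrow> run K Synth \<Gamma> t \<bind> trunc_of;
     run K (Check (A \<rightarrow> P)) \<Gamma> f;
     Some P})"
| "run K m \<Gamma> (Funext f g h) = accept K m \<Gamma> (do {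
     (A, B) \<leftarrow> run K Synth \<Gamma> f \<bind> pi_of;
     run K (Check (Pi A B)) \<Gamma> g;
     run K (Check (Pi A (Eq B (f \<up> 1 \<cdot> Var 0) (g \<up> 1 \<cdot> Var 0)))) \<Gamma> h;
     Some (Eq (Pi A B) f g)})"
| "run K m \<Gamma> (Propext P Q h k f g) = None"

section \<open>Soundness of the checker\<close>

definition sound :: "judge \<Rightarrow> bool" where
  "sound K \<longleftrightarrow>
     (\<forall>\<Gamma> A. wf \<Gamma> \<longrightarrow> fst K \<Gamma> A \<longrightarrow> (\<exists>i. \<Gamma> \<turnstile> A \<Colon> Univ i)) \<and>
     (\<forall>\<Gamma> A B. wf \<Gamma> \<longrightarrow> snd K \<Gamma> A B \<longrightarrow> (\<exists>i. \<Gamma> \<turnstile> A \<doteq> B \<Colon> Univ i))"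

lemma sound_type: "sound K \<Longrightarrow> wf \<Gamma> \<Longrightarrow> fst K \<Gamma> A \<Longrightarrow> \<exists>i. \<Gamma> \<turnstile> A \<Colon> Univ i"
  by (simp add: sound_def)

lemma sound_wf: "sound K \<Longrightarrow> wf \<Gamma> \<Longrightarrow> fst K \<Gamma> A \<Longrightarrow> wf (A # \<Gamma>)"
  using sound_type wf_Cons by blast

lemma sound_conv: "sound K \<Longrightarrow> wf \<Gamma> \<Longrightarrow> snd K \<Gamma> A B \<Longrightarrow> \<Gamma> \<turnstile> t \<Colon> A \<Longrightarrow> \<Gamma> \<turnstile> t \<Colon> B"
  unfolding sound_def using ty_conv by blast

text \<open>In mode \<open>Dom A\<close> the clause of \<open>Lam\<close> takes \<open>A\<close> for
  granted: its caller, the redex clause of \<open>App\<close>, has already asked the judge about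
  it.\<close>

definition pre :: "tm list \<Rightarrow> mode \<Rightarrow> bool" where
  "pre \<Gamma> m \<longleftrightarrow> wf \<Gamma> \<and> (\<forall>A. m = Dom A \<longrightarrow> (\<exists>i. \<Gamma> \<turnstile> A \<Colon> Univ i))"

definition post :: "tm list \<Rightarrow> mode \<Rightarrow> tm \<Rightarrow> tm \<Rightarrow> bool" where
  "post \<Gamma> m t T \<longleftrightarrow> \<Gamma> \<turnstile> t \<Colon> T \<and> (\<forall>U. m = Check U \<longrightarrow> T = U)"

definition good :: "judge \<Rightarrow> tm \<Rightarrow> bool" where
  "good K t \<longleftrightarrow> (\<forall>m \<Gamma> T. pre \<Gamma> m \<longrightarrow> run K m \<Gamma> t = Some T \<longrightarrow> post \<Gamma> m t T)"

lemma goodI: "(\<And>m \<Gamma> T. pre \<Gamma> m \<Longrightarrow> run K m \<Gamma> t = Some T \<Longrightarrow> post \<Gamma> m t T) \<Longrightarrow> good K t"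
  by (simp add: good_def)

lemma goodD:
  assumes "good K t" "wf \<Gamma>"
  shows "run K Synth \<Gamma> t = Some T \<Longrightarrow> \<Gamma> \<turnstile> t \<Colon> T"
    and "run K (Check U) \<Gamma> t = Some T \<Longrightarrow> \<Gamma> \<turnstile> t \<Colon> U"
    and "run K (Dom A) \<Gamma> t = Some T \<Longrightarrow> \<Gamma> \<turnstile> A \<Colon> Univ i \<Longrightarrow> \<Gamma> \<turnstile> t \<Colon> T"
  using assms unfolding good_def pre_def post_def by blast+

text \<open>Most constructors have one synthesis clause wrapped in \<open>accept\<close>. For these
  only \<open>r\<close> has to be justified; the mode \<open>Check\<close> adds at most one use of
  conversion.\<close>

lemma accept_good:
  assumes "sound K" "\<And>m \<Gamma>. run K m \<Gamma> t = accept K m \<Gamma> (r \<Gamma>)"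
    and "\<And>\<Gamma> T. wf \<Gamma> \<Longrightarrow> r \<Gamma> = Some T \<Longrightarrow> \<Gamma> \<turnstile> t \<Colon> T"
  shows "good K t"
proof (rule goodI)
  fix m \<Gamma> T
  assume "pre \<Gamma> m" "run K m \<Gamma> t = Some T"
  then show "post \<Gamma> m t T"
    using assms sound_conv[of K \<Gamma>]
    by (cases m) (auto simp: accept_def post_def pre_def bind_eq_Some_conv split: if_splits)
qed

text \<open>Structural induction goes through because each premise of a typing rule comes from a
  recursive call or from an answer of \<open>K\<close>. Constructors on which \<open>run\<close>
  always fails satisfy the claim vacuously.\<close>

lemma run_good:
  assumes K: "sound K"
  shows "good K t"
proof -
  note T = sound_type[OF K] and C = sound_conv[OF K]
  show ?thesis
  proof (induction t)
    case (Var i)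
    show ?case
      by (rule accept_good[OF K run.simps(1)])
        (auto simp: bind_eq_Some_conv split: if_splits intro: ty_Var[simplified])
  next
    case (Univ l)
    show ?case
      by (rule accept_good[OF K run.simps(2)])
        (auto simp: bind_eq_Some_conv split: if_splits intro: ty_Univ)
  next
    case (Empty l)
    show ?case
      by (rule accept_good[OF K run.simps(14)])
        (auto simp: bind_eq_Some_conv split: if_splits intro: ty_Empty)
  next
    case (Unit l)
    show ?case
      by (rule accept_good[OF K run.simps(16)])
        (auto simp: bind_eq_Some_conv split: if_splits intro: ty_Unit)
  next
    case (Star l)
    show ?case
      by (rule accept_good[OF K run.simps(17)])
        (auto simp: bind_eq_Some_conv split: if_splits intro: ty_Star)
  next
    case (Pi A B)
    note IH = goodD[OF Pi(1)] goodD[OF Pi(2)]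
    show ?case
      by (rule accept_good[OF K run.simps(3)], clarsimp simp: bind_eq_Some_conv)
        (blast intro: IH ty_Pi wf_Cons)
  next
    case (Lam t)
    note IH = goodD[OF Lam]
    show ?case
    proof (rule goodI)
      fix m \<Gamma> T
      assume "pre \<Gamma> m" "run K m \<Gamma> (Lam t) = Some T"
      then show "post \<Gamma> m (Lam t) T"
        by (cases m; clarsimp simp: bind_eq_Some_conv post_def pre_def split: if_splits)
          (blast intro: IH ty_Lam wf_Cons dest: T)+
    qed
  next
    case (App f a)
    note IH = goodD[OF App(1)] goodD[OF App(2)]
    show ?case
    proof (rule accept_good[OF K run.simps(5)])
      fix \<Gamma> T
      assume W: "wf \<Gamma>" and r: "(if Option.is_none (lam_of f)
        then do {
          (A, B) \<leftarrow> run K Synth \<Gamma> f \<bind> pi_of;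
          run K (Check A) \<Gamma> a;
          Some (inst B a)}
        else do {
          A \<leftarrow> run K Synth \<Gamma> a;
          assert (fst K \<Gamma> A);
          (A', B) \<leftarrow> run K (Dom A) \<Gamma> f \<bind> pi_of;
          assert (A' = A);
          Some (inst B a)}) = Some T"
      show "\<Gamma> \<turnstile> f \<cdot> a \<Colon> T"
      proof (cases "lam_of f")
        case None
        with r W show ?thesis
          by (clarsimp simp: bind_eq_Some_conv Option.is_none_def) (blast intro: IH ty_App)
      next
        case (Some b)
        with r obtain A B where *: "run K Synth \<Gamma> a = Some A" "fst K \<Gamma> A"
          "run K (Dom A) \<Gamma> f = Some (Pi A B)" "T = inst B a"
          by (clarsimp simp: bind_eq_Some_conv Option.is_none_def split: if_splits)
        with T W obtain i where "\<Gamma> \<turnstile> A \<Colon> Univ i" by blast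
        with * W show ?thesis
          by (blast intro: IH ty_App)
      qed
    qed
  next
    case (Sig A B)
    note IH = goodD[OF Sig(1)] goodD[OF Sig(2)]
    show ?case
      by (rule accept_good[OF K run.simps(6)], clarsimp simp: bind_eq_Some_conv)
        (blast intro: IH ty_Sig wf_Cons)
  next
    case (Tup a b)
    show ?case
    proof (rule goodI)
      fix m \<Gamma> T
      assume "pre \<Gamma> m" and r: "run K m \<Gamma> (Tup a b) = Some T"
      then have W: "wf \<Gamma>" by (simp add: pre_def)
      from r obtain U A B T1 T2 where *: "m = Check U" "U = Sig A B" "T = U"
        "fst K \<Gamma> A" "fst K (A # \<Gamma>) B"
        "run K (Check A) \<Gamma> a = Some T1" "run K (Check (inst B a)) \<Gamma> b = Some T2"
        by (cases m) (auto simp: bind_eq_Some_conv split: if_splits)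
      from T[OF W *(4)] obtain i where i: "\<Gamma> \<turnstile> A \<Colon> Univ i" ..
      from T[OF wf_Cons[OF W i] *(5)] obtain j where j: "A # \<Gamma> \<turnstile> B \<Colon> Univ j" ..
      from ty_Tup[OF i j goodD(2)[OF Tup(1) W *(6)] goodD(2)[OF Tup(2) W *(7)]] *
      show "post \<Gamma> m (Tup a b) T"
        by (simp add: post_def)
    qed
  next
    case (Proj1 p)
    note IH = goodD[OF Proj1]
    show ?case
      by (rule accept_good[OF K run.simps(8)], clarsimp simp: bind_eq_Some_conv)
        (blast intro: IH ty_Proj1 wf_Cons)
  next
    case (Proj2 p)
    note IH = goodD[OF Proj2]
    show ?case
      by (rule accept_good[OF K run.simps(9)], clarsimp simp: bind_eq_Some_conv)
        (blast intro: IH ty_Proj2 wf_Cons)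
  next
    case (Coprod A B)
    note IH = goodD[OF Coprod(1)] goodD[OF Coprod(2)]
    show ?case
      by (rule accept_good[OF K run.simps(10)], clarsimp simp: bind_eq_Some_conv)
        (blast intro: IH ty_Coprod wf_Cons)
  next
    case (InL a)
    note IH = goodD[OF InL]
    show ?case
    proof (rule goodI)
      fix m \<Gamma> T
      assume "pre \<Gamma> m" "run K m \<Gamma> (InL a) = Some T"
      then show "post \<Gamma> m (InL a) T"
        by (cases m; clarsimp simp: bind_eq_Some_conv post_def pre_def split: if_splits)
          (blast intro: IH ty_InL ty_Unit wf_Cons dest: T)+
    qed
  next
    case (InR b)
    note IH = goodD[OF InR]
    show ?case
    proof (rule goodI)
      fix m \<Gamma> T
      assume "pre \<Gamma> m" "run K m \<Gamma> (InR b) = Some T"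
      then show "post \<Gamma> m (InR b) T"
        by (cases m; clarsimp simp: bind_eq_Some_conv post_def pre_def split: if_splits)
          (blast intro: IH ty_InR ty_Unit wf_Cons dest: T)+
    qed
  next
    case (CaseOf C s t u)
    note IH = goodD[OF CaseOf(1)] goodD[OF CaseOf(2)] goodD[OF CaseOf(3)] goodD[OF CaseOf(4)]
    show ?case
    proof (rule accept_good[OF K run.simps(13)], goal_cases)
      case (1 \<Gamma> T)
      then obtain A B k T1 T2 where *: "run K Synth \<Gamma> u = Some (Coprod A B)" "fst K \<Gamma> A" "fst K \<Gamma> B"
        "run K Synth (Coprod A B # \<Gamma>) C = Some (Univ k)"
        "run K (Check (inst_branch C 1 (InL (Var 0)))) (A # \<Gamma>) s = Some T1"
        "run K (Check (inst_branch C 1 (InR (Var 0)))) (B # \<Gamma>) t = Some T2" "T = inst C u"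
        by (clarsimp simp: bind_eq_Some_conv Option.is_none_def split: if_splits)
      obtain i j where ij: "\<Gamma> \<turnstile> A \<Colon> Univ i" "\<Gamma> \<turnstile> B \<Colon> Univ j"
        using T[OF 1(1)] *(2,3) by blast
      then have "wf (A # \<Gamma>)" "wf (B # \<Gamma>)" "wf (Coprod A B # \<Gamma>)"
        using 1(1) by (auto intro: wf_Cons ty_Coprod)
      with * 1(1) show ?case
        by (blast intro: ty_CaseOf IH)
    qed
  next
    case (Abort C e)
    note IH = goodD[OF Abort(1)] goodD[OF Abort(2)]
    show ?case
      by (rule accept_good[OF K run.simps(15)], clarsimp simp: bind_eq_Some_conv)
        (blast intro: IH ty_Abort ty_Empty wf_Cons)
  next
    case (UnitRec C c u)
    note IH = goodD[OF UnitRec(1)] goodD[OF UnitRec(2)] goodD[OF UnitRec(3)]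
    show ?case
      by (rule accept_good[OF K run.simps(18)], clarsimp simp: bind_eq_Some_conv)
        (blast intro: IH ty_UnitRec ty_Unit wf_Cons)
  next
    case (Eq A a b)
    note IH = goodD[OF Eq(1)] goodD[OF Eq(2)] goodD[OF Eq(3)]
    show ?case
      by (rule accept_good[OF K run.simps(23)], clarsimp simp: bind_eq_Some_conv)
        (blast intro: IH ty_Eq wf_Cons)
  next
    case (Rfl a)
    note IH = goodD[OF Rfl]
    show ?case
    proof (rule goodI)
      fix m \<Gamma> T
      assume "pre \<Gamma> m" "run K m \<Gamma> (Rfl a) = Some T"
      then show "post \<Gamma> m (Rfl a) T"
        by (cases m; clarsimp simp: bind_eq_Some_conv post_def pre_def split: if_splits)
          (blast intro: IH ty_Rfl C wf_Cons dest: T)+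
    qed
  next
    case (J A a C d b p)
    note IH = goodD[OF J(1)] goodD[OF J(2)] goodD[OF J(3)] goodD[OF J(4)] goodD[OF J(5)] goodD[OF J(6)]
    show ?case
    proof (rule accept_good[OF K run.simps(25)], goal_cases)
      case (1 \<Gamma> T)
      let ?E = "Eq (A \<up> 1) (a \<up> 1) (Var 0)"
      from 1 obtain i k T1 T2 T3 T4 where *: "run K Synth \<Gamma> A = Some (Univ i)" "fst K (A # \<Gamma>) ?E"
        "run K (Check A) \<Gamma> a = Some T1"
        "run K Synth (?E # A # \<Gamma>) C = Some (Univ k)"
        "run K (Check (inst2 C a (Rfl a))) \<Gamma> d = Some T2"
        "run K (Check A) \<Gamma> b = Some T3"
        "run K (Check (Eq A a b)) \<Gamma> p = Some T4" "T = inst2 C b p"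
        by (clarsimp simp: bind_eq_Some_conv Option.is_none_def split: if_splits)
      \<comment> \<open>The judge is trusted over well-formed contexts only, so the context
        \<open>A # \<Gamma>\<close> has to be secured before its answer about the path type can be
        used.\<close>
      have W': "wf (A # \<Gamma>)"
        using IH(1)[OF 1(1) *(1)] 1(1) by (auto intro: wf_Cons)
      from sound_wf[OF K this *(2)] * 1(1) show ?case
        by (blast intro: ty_J IH)
    qed
  next
    case (Trunc A)
    note IH = goodD[OF Trunc]
    show ?case
      by (rule accept_good[OF K run.simps(26)], clarsimp simp: bind_eq_Some_conv)
        (blast intro: IH ty_Trunc wf_Cons)
  next
    case (TrIn a)
    note IH = goodD[OF TrIn]
    show ?case
    proof (rule goodI)
      fix m \<Gamma> T
      assume "pre \<Gamma> m" "run K m \<Gamma> (TrIn a) = Some T"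
      then show "post \<Gamma> m (TrIn a) T"
        by (cases m; clarsimp simp: bind_eq_Some_conv post_def pre_def split: if_splits)
          (blast intro: IH ty_TrIn wf_Cons dest: T)+
    qed
  next
    case (Squash s t)
    note IH = goodD[OF Squash(1)] goodD[OF Squash(2)]
    show ?case
      by (rule accept_good[OF K run.simps(28)], clarsimp simp: bind_eq_Some_conv)
        (blast intro: IH ty_Squash wf_Cons)
  next
    case (TrRec P h f t)
    note IH = goodD[OF TrRec(1)] goodD[OF TrRec(2)] goodD[OF TrRec(3)] goodD[OF TrRec(4)]
    show ?case
      by (rule accept_good[OF K run.simps(29)], clarsimp simp: bind_eq_Some_conv)
        (rule ty_TrRec[simplified]; rule IH; assumption)
  next
    case (Funext f g h)
    note IH = goodD[OF Funext(1)] goodD[OF Funext(2)] goodD[OF Funext(3)]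
    show ?case
      by (rule accept_good[OF K run.simps(30)], clarsimp simp: bind_eq_Some_conv)
        (rule ty_Funext[simplified]; rule IH; assumption)
  qed (simp_all add: good_def)
qed

lemma run_Synth: "sound K \<Longrightarrow> wf \<Gamma> \<Longrightarrow> run K Synth \<Gamma> t = Some T \<Longrightarrow> \<Gamma> \<turnstile> t \<Colon> T"
  using goodD(1)[OF run_good] .

lemma run_Check: "sound K \<Longrightarrow> wf \<Gamma> \<Longrightarrow> run K (Check U) \<Gamma> t = Some T \<Longrightarrow> \<Gamma> \<turnstile> t \<Colon> U"
  using goodD(2)[OF run_good] .

section \<open>Conversion by reduction\<close>

text \<open>One parallel reduction step; the second component of the result is the type.\<close>

fun red :: "judge \<Rightarrow> tm list \<Rightarrow> tm \<Rightarrow> (tm \<times> tm) option" where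
  "red K \<Gamma> (App f a) = (case lam_of f of
     Some b \<Rightarrow> do {
       A \<leftarrow> run K Synth \<Gamma> a;
       assert (fst K \<Gamma> A);
       B \<leftarrow> run K Synth (A # \<Gamma>) b;
       Some (inst b a, inst B a)}
   | None \<Rightarrow> do {
       (f', T) \<leftarrow> red K \<Gamma> f;
       (A, B) \<leftarrow> pi_of T;
       (a', A') \<leftarrow> red K \<Gamma> a;
       assert (A' = A);
       Some (f' \<cdot> a', inst B a)})"
| "red K \<Gamma> (CaseOf C s t u) = do {
     T \<leftarrow> run K Synth \<Gamma> (CaseOf C s t u);
     Some (case u of InL a \<Rightarrow> inst s a | InR b \<Rightarrow> inst t b | _ \<Rightarrow> CaseOf C s t u, T)}"
| "red K \<Gamma> (UnitRec C c u) = do {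
     T \<leftarrow> run K Synth \<Gamma> (UnitRec C c u);
     Some (case u of Star i \<Rightarrow> c | _ \<Rightarrow> UnitRec C c u, T)}"
| "red K \<Gamma> (Pi A B) = do {
     (A', S) \<leftarrow> red K \<Gamma> A;
     i \<leftarrow> level_of S;
     (B', T) \<leftarrow> red K (A # \<Gamma>) B;
     j \<leftarrow> level_of T;
     Some (Pi A' B', Univ (max i j))}"
| "red K \<Gamma> (Eq A a b) = do {
     (A', S) \<leftarrow> red K \<Gamma> A;
     i \<leftarrow> level_of S;
     (a', T) \<leftarrow> red K \<Gamma> a;
     assert (T = A);
     (b', U) \<leftarrow> red K \<Gamma> b;
     assert (U = A);
     Some (Eq A' a' b', Univ i)}"
| "red K \<Gamma> t = do {T \<leftarrow> run K Synth \<Gamma> t; Some (t, T)}"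

text \<open>The typing of \<open>t\<close> is carried along with the equation because the induction
  consumes it: \<open>cong_Pi\<close> asks for the typing of the domain, and the recursive call on
  the codomain for the well-formedness of the context extended by it.\<close>

lemma red_sound: "sound K \<Longrightarrow> wf \<Gamma> \<Longrightarrow> red K \<Gamma> t = Some (t', T) \<Longrightarrow> \<Gamma> \<turnstile> t \<Colon> T \<and> \<Gamma> \<turnstile> t \<doteq> t' \<Colon> T"
proof (induction K \<Gamma> t arbitrary: t' T rule: red.induct)
  case (1 K \<Gamma> f a)
  note T = sound_type[OF 1(3,4)] and R = run_Synth[OF 1(3)]
  show ?case
  proof (cases f)
    case (Lam b)
    with 1(3-) show ?thesis
      by (clarsimp simp: bind_eq_Some_conv Option.is_none_def split: if_splits)
        (blast intro: eq_Pi_beta ty_App ty_Lam wf_Cons R dest: T)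
  qed (use 1 in \<open>clarsimp simp: bind_eq_Some_conv split: if_splits; blast intro: cong_App ty_App\<close>)+
next
  case (2 K \<Gamma> C s t u)
  note R = run_Synth[OF 2(1)] and W = 2(2) and T = sound_type[OF 2(1,2)] and Ck = run_Check[OF 2(1)]
  have ty: "\<Gamma> \<turnstile> CaseOf C s t u \<Colon> T"
    using 2 R by (auto simp del: run.simps simp: bind_eq_Some_conv)
  from 2(3) obtain A B k T1 T2 where *: "run K Synth \<Gamma> u = Some (Coprod A B)" "fst K \<Gamma> A" "fst K \<Gamma> B"
    "run K Synth (Coprod A B # \<Gamma>) C = Some (Univ k)"
    "run K (Check (inst_branch C 1 (InL (Var 0)))) (A # \<Gamma>) s = Some T1"
    "run K (Check (inst_branch C 1 (InR (Var 0)))) (B # \<Gamma>) t = Some T2"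
    and r: "t' = (case u of InL a \<Rightarrow> inst s a | InR b \<Rightarrow> inst t b | _ \<Rightarrow> CaseOf C s t u)" "T = inst C u"
    by (fastforce simp: bind_eq_Some_conv accept_def split: if_splits)
  from T *(2,3) obtain i j where AB: "\<Gamma> \<turnstile> A \<Colon> Univ i" "\<Gamma> \<turnstile> B \<Colon> Univ j"
    by blast
  with W have "wf (A # \<Gamma>)" "wf (B # \<Gamma>)" "wf (Coprod A B # \<Gamma>)"
    by (auto intro: wf_Cons ty_Coprod)
  then have br: "Coprod A B # \<Gamma> \<turnstile> C \<Colon> Univ k" "A # \<Gamma> \<turnstile> s \<Colon> inst_branch C 1 (InL (Var 0))"
      "B # \<Gamma> \<turnstile> t \<Colon> inst_branch C 1 (InR (Var 0))"
    using R Ck * by blast+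
  show ?case
  proof (cases u)
    case (InL a)
    \<comment> \<open>Synthesis of \<open>InL a\<close> takes the left summand from \<open>a\<close>
      and puts \<open>Unit 0\<close> on the right, so \<open>A\<close> is the type synthesized for
      \<open>a\<close>.\<close>
    with *(1) obtain "run K Synth \<Gamma> a = Some A"
      by (auto simp: bind_eq_Some_conv)
    then have "\<Gamma> \<turnstile> a \<Colon> A"
      using R W by blast
    with ty br r InL show ?thesis
      by (auto intro: eq_Coprod_beta1)
  next
    case (InR b)
    with *(1) obtain "run K Synth \<Gamma> b = Some B"
      by (auto simp: bind_eq_Some_conv)
    then have "\<Gamma> \<turnstile> b \<Colon> B"
      using R W by blast
    with ty br r InR show ?thesis
      by (auto intro: eq_Coprod_beta2)
  qed (use ty r in \<open>auto intro: eq_refl\<close>)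
next
  case (3 K \<Gamma> C c u)
  note R = run_Synth[OF 3(1)] and W = 3(2) and Ck = run_Check[OF 3(1)]
  have ty: "\<Gamma> \<turnstile> UnitRec C c u \<Colon> T"
    using 3 R by (auto simp del: run.simps simp: bind_eq_Some_conv)
  from 3(3) obtain i k T1 where *: "run K Synth \<Gamma> u = Some (Unit i)"
    "run K Synth (Unit i # \<Gamma>) C = Some (Univ k)"
    "run K (Check (inst C (Star i))) \<Gamma> c = Some T1"
    and r: "t' = (case u of Star i \<Rightarrow> c | _ \<Rightarrow> UnitRec C c u)" "T = inst C u"
    by (fastforce simp: bind_eq_Some_conv accept_def)
  have "wf (Unit i # \<Gamma>)"
    using W by (auto intro: wf_Cons ty_Unit)
  then have "Unit i # \<Gamma> \<turnstile> C \<Colon> Univ k" "\<Gamma> \<turnstile> c \<Colon> inst C (Star i)"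
    using R Ck W * by blast+
  with ty r *(1) show ?case
    by (cases u) (auto simp: accept_def intro: eq_Unit_beta eq_refl)
next
  case (4 K \<Gamma> A B)
  then show ?case
    by (clarsimp simp: bind_eq_Some_conv) (blast intro: cong_Pi ty_Pi wf_Cons)
next
  case (5 K \<Gamma> A a b)
  then show ?case
    by (clarsimp simp: bind_eq_Some_conv Option.is_none_def split: if_splits)
      (blast intro: cong_Eq ty_Eq)
qed (auto simp del: run.simps simp: bind_eq_Some_conv intro: eq_refl dest: run_Synth)

text \<open>Conversion is tested by rewriting one side until it is literally the other. Consecutive
  levels are compared because \<open>eq_trans\<close> wants one common type. The bound
  \<open>4\<close> in \<open>layer\<close> is what unfolding
  \<open>two_le v \<cdot> a \<cdot> b\<close> takes: an ascription, a beta step, the inner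
  ascription, another beta step.\<close>

primrec steps :: "judge \<Rightarrow> nat \<Rightarrow> tm list \<Rightarrow> tm \<Rightarrow> tm \<Rightarrow> nat option" where
  "steps K 0 \<Gamma> T U = None"
| "steps K (Suc n) \<Gamma> T U = do {
     (T', S) \<leftarrow> red K \<Gamma> T;
     i \<leftarrow> level_of S;
     if T' = U then Some i else do {
       j \<leftarrow> steps K n \<Gamma> T' U;
       assert (j = i);
       Some i}}"

lemma steps_sound: "sound K \<Longrightarrow> wf \<Gamma> \<Longrightarrow> steps K n \<Gamma> T U = Some i \<Longrightarrow> \<Gamma> \<turnstile> T \<doteq> U \<Colon> Univ i"
proof (induction n arbitrary: T i)
  case (Suc n)
  then show ?case
    by (auto simp: bind_eq_Some_conv dest!: red_sound split: if_splits intro: eq_trans)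
qed simp

text \<open>The judge of each layer is the checker run with the judge of the layer below.\<close>

primrec layer :: "nat \<Rightarrow> judge" where
  "layer 0 = (\<lambda>\<Gamma> A. False, \<lambda>\<Gamma> T U. False)"
| "layer (Suc n) =
    (\<lambda>\<Gamma> A. \<not> Option.is_none (run (layer n) Synth \<Gamma> A \<bind> level_of),
     \<lambda>\<Gamma> T U. if Option.is_none (steps (layer n) 4 \<Gamma> T U)
       then \<not> Option.is_none (steps (layer n) 4 \<Gamma> U T) else True)"

lemma sound_layer: "sound (layer n)"
proof (induction n)
  case (Suc n)
  then show ?case
    unfolding sound_def[of "layer (Suc n)"]
    by (auto simp: bind_eq_Some_conv Option.is_none_def
        dest: run_Synth steps_sound eq_sym split: if_splits)
qed (simp add: sound_def)

abbreviation layer1 :: judge where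
  "layer1 \<equiv> layer (Suc 0)"

abbreviation layer2 :: judge where
  "layer2 \<equiv> layer (Suc (Suc 0))"

lemma run_layer_typing: "run (layer n) Synth \<Gamma> t = Some T \<Longrightarrow> wf \<Gamma> \<Longrightarrow> \<Gamma> \<turnstile> t \<Colon> T"
  using run_Synth[OF sound_layer] .


section \<open>Evaluation of the type checker by rewriting\<close>

text \<open>
  A type ascription, encoded by recursion over the unit type with a constant motive: it lets the
  checker synthesize the type of a term built from unannotated abstractions.
\<close>

definition asc :: "tm \<Rightarrow> tm \<Rightarrow> tm" where
  "asc T t = UnitRec (T \<up> 1) t (Star 0)"

primrec lams :: "nat \<Rightarrow> tm \<Rightarrow> tm" where
  "lams 0 t = t"
| "lams (Suc n) t = Lam (lams n t)"

lemma layer_simps: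
  "fst (layer 0) \<Gamma> A \<longleftrightarrow> False"
  "snd (layer 0) \<Gamma> T U \<longleftrightarrow> False"
  "fst (layer (Suc n)) \<Gamma> A \<longleftrightarrow> \<not> Option.is_none (run (layer n) Synth \<Gamma> A \<bind> level_of)"
  "snd (layer (Suc n)) \<Gamma> T U \<longleftrightarrow> (if Option.is_none (steps (layer n) 4 \<Gamma> T U)
    then \<not> Option.is_none (steps (layer n) 4 \<Gamma> U T) else True)"
  by simp_all

lemma accept_simps:
  "accept K Synth \<Gamma> r = r"
  "accept K (Dom A) \<Gamma> r = r"
  "accept K (Check U) \<Gamma> r =
     do {T \<leftarrow> r; if T = U then Some U else if snd K \<Gamma> T U then Some U else None}"
  by (simp_all add: accept_def)

lemma up_simps:
  "up_ren r 0 = 0" "up_ren r (Suc i) = Suc (r i)"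
  "up_sub s 0 = Var 0" "up_sub s (Suc i) = rename Suc (s i)"
  by (simp_all add: up_ren_def up_sub_def)

lemma bind_weak_cong: "x = y \<Longrightarrow> Option.bind x f = Option.bind y f"
  by simp

text \<open>These congruences stop the simplifier from evaluating a continuation before its argument.\<close>

lemmas typecheck_cong = bind_weak_cong prod.case_cong_weak if_weak_cong option.case_cong_weak
  tm.case_cong_weak mode.case_cong_weak

lemmas typecheck = run.simps red.simps steps.simps rename.simps subst.simps lams.simps
  level_of.simps pi_of.simps sig_of.simps coprod_of.simps eq_of.simps trunc_of.simps empty_of.simps
  unit_of.simps lam_of.simps
  layer_simps accept_simps up_simps inst_def inst2_def inst_branch_def asc_def
  is_prop_def neg_def equivalence_def reflexive_def transitive_def antisymmetric_def prop_valued_def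
  poset_axioms_def poset_trans_def is_sup_def has_sup_def delta_index_def delta_def delta_complete_def
  delta_sup_def strictly_below_def positive_def locally_small_def stable_equality_def
  decidable_equality_def positive_poset_def excluded_middle_def
  One_nat_def numeral_eq_Suc pred_numeral_simps BitM.simps add_0_right add_Suc_right
  Option.bind.simps Option.is_none_simps if_True if_False HOL.simp_thms
  nth_Cons_0 nth_Cons_Suc list.size Suc_less_eq zero_less_Suc not_less_zero
  nat.case option.case mode.case tm.case prod.case fst_conv snd_conv
  nat.inject nat.distinct option.inject option.distinct tm.inject tm.distinct
  max.idem max_0L max_0R

text \<open>A constant is checked once; afterwards its \<open>run\<close> lemma returns its type
  without visiting its body. Closedness makes renaming and substitution stop at it, and the value
  \<open>None\<close> of \<open>lam_of\<close> sends its applications to the clause of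
  \<open>App\<close> that synthesizes the type of the function.\<close>

named_theorems certified


section \<open>Excluded middle from stable equality\<close>

abbreviation dec :: "tm \<Rightarrow> tm" where
  "dec A \<equiv> Coprod A (neg A)"

abbreviation trunc_is_prop :: tm where
  "trunc_is_prop \<equiv> Lam (Lam (Squash (Var 1) (Var 0)))"

abbreviation poset_refl :: "tm \<Rightarrow> tm" where
  "poset_refl ax \<equiv> Proj1 (Proj2 ax)"

abbreviation poset_antisym :: "tm \<Rightarrow> tm" where
  "poset_antisym ax \<equiv> Proj2 (Proj2 (Proj2 ax))"

abbreviation delta_upper :: "tm \<Rightarrow> tm \<Rightarrow> tm \<Rightarrow> tm \<Rightarrow> tm \<Rightarrow> tm \<Rightarrow> tm" where
  "delta_upper c x y l P h \<equiv> Proj1 (Proj2 (c \<cdot> x \<cdot> y \<cdot> l \<cdot> P \<cdot> h))"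

abbreviation delta_least :: "tm \<Rightarrow> tm \<Rightarrow> tm \<Rightarrow> tm \<Rightarrow> tm \<Rightarrow> tm \<Rightarrow> tm" where
  "delta_least c x y l P h \<equiv> Proj2 (Proj2 (c \<cdot> x \<cdot> y \<cdot> l \<cdot> P \<cdot> h))"

(* In T: X = 2, R = 1, ax = 0. *)
abbreviation posets :: "nat \<Rightarrow> nat \<Rightarrow> tm \<Rightarrow> tm" where
  "posets u t T \<equiv>
    Pi (Univ u) (Pi (Var 0 \<rightarrow> Var 0 \<rightarrow> Univ t) (Pi (poset_axioms (Var 1) (Var 0)) T))"

(* In T: X = 3, R = 2, ax = 1, c = 0. *)
abbreviation delta_posets :: "nat \<Rightarrow> nat \<Rightarrow> nat \<Rightarrow> tm \<Rightarrow> tm" where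
  "delta_posets v u t T \<equiv> posets u t (Pi (delta_complete v (Var 2) (Var 1)) T)"

(* In T: X = 8, R = 7, ax = 6, c = 5, x = 4, y = 3, l : R x y = 2, P = 1, h : is_prop P = 0. *)
abbreviation delta_families :: "nat \<Rightarrow> nat \<Rightarrow> nat \<Rightarrow> tm \<Rightarrow> tm" where
  "delta_families v u t T \<equiv> delta_posets v u t
    (Pi (Var 3) (Pi (Var 4) (Pi (Var 4 \<cdot> Var 1 \<cdot> Var 0) (Pi (Univ v) (Pi (is_prop (Var 0)) T)))))"

text \<open>The equation is oriented as in \<open>strictly_below\<close>, so that its stabilized
  form is accepted by strictness as it stands.\<close>

definition sup_eq_top_type :: "nat \<Rightarrow> nat \<Rightarrow> nat \<Rightarrow> tm" where
  "sup_eq_top_type v u t =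
    delta_families v u t
      (Var 1 \<rightarrow> Eq (Var 8) (Var 3) (delta_sup (Var 5) (Var 4) (Var 3) (Var 2) (Var 1) (Var 0)))"

(* p : P |-> antisym y s (upper (inr p)) (least y (i |-> case i of inl _ => l | inr _ => refl y)) *)
definition sup_eq_top :: "nat \<Rightarrow> nat \<Rightarrow> nat \<Rightarrow> tm" where
  "sup_eq_top v u t = asc (sup_eq_top_type v u t)
    (lams 10
       (poset_antisym (Var 7) \<cdot> Var 4 \<cdot>
          delta_sup (Var 6) (Var 5) (Var 4) (Var 3) (Var 2) (Var 1) \<cdot>
          (delta_upper (Var 6) (Var 5) (Var 4) (Var 3) (Var 2) (Var 1) \<cdot> InR (Var 0)) \<cdot>
          (delta_least (Var 6) (Var 5) (Var 4) (Var 3) (Var 2) (Var 1) \<cdot> Var 4 \<cdot>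
             Lam
               (CaseOf (Var 10 \<cdot> (delta (Var 11) (Var 7) (Var 6) \<cdot> Var 0) \<cdot> Var 6) (Var 5)
                  (poset_refl (Var 9) \<cdot> Var 6) (Var 0)))))"

lemma sup_eq_top_closed [certified]:
  "rename r (sup_eq_top v u t) = sup_eq_top v u t"
  "subst s (sup_eq_top v u t) = sup_eq_top v u t"
  "lam_of (sup_eq_top v u t) = None"
  by (simp_all only: sup_eq_top_def sup_eq_top_type_def certified typecheck)

text \<open>The motive of the case analysis keeps the application of \<open>delta\<close> to the
  index. At \<open>InL\<close> and \<open>InR\<close> it computes to x and y in two steps, and
  conversion accepts the branches.\<close>

lemma run_sup_eq_top [certified]:
  "run layer2 m \<Gamma> (sup_eq_top v u t) =
    accept layer2 m \<Gamma> (Some (sup_eq_top_type v u t))"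
  by (simp only: sup_eq_top_def sup_eq_top_type_def
      certified typecheck cong: typecheck_cong)

declare sup_eq_top_type_def [certified]

definition sup_le_bot_type :: "nat \<Rightarrow> nat \<Rightarrow> nat \<Rightarrow> tm" where
  "sup_le_bot_type v u t =
    delta_families v u t
      (neg (Var 1) \<rightarrow>
       Var 7 \<cdot> delta_sup (Var 5) (Var 4) (Var 3) (Var 2) (Var 1) (Var 0) \<cdot> Var 4)"

(* n : neg P |-> least x (i |-> case i of inl _ => refl x | inr p => abort (n p)) *)
definition sup_le_bot :: "nat \<Rightarrow> nat \<Rightarrow> nat \<Rightarrow> tm" where
  "sup_le_bot v u t = asc (sup_le_bot_type v u t)
    (lams 10
       (delta_least (Var 6) (Var 5) (Var 4) (Var 3) (Var 2) (Var 1) \<cdot> Var 5 \<cdot>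
          Lam
            (CaseOf (Var 10 \<cdot> (delta (Var 11) (Var 7) (Var 6) \<cdot> Var 0) \<cdot> Var 7)
               (poset_refl (Var 9) \<cdot> Var 7) (Abort (Var 11 \<cdot> Var 7 \<cdot> Var 8) (Var 2 \<cdot> Var 0))
               (Var 0))))"

lemma sup_le_bot_closed [certified]:
  "rename r (sup_le_bot v u t) = sup_le_bot v u t"
  "subst s (sup_le_bot v u t) = sup_le_bot v u t"
  "lam_of (sup_le_bot v u t) = None"
  by (simp_all only: sup_le_bot_def sup_le_bot_type_def certified typecheck)

lemma run_sup_le_bot [certified]:
  "run layer2 m \<Gamma> (sup_le_bot v u t) =
    accept layer2 m \<Gamma> (Some (sup_le_bot_type v u t))"
  by (simp only: sup_le_bot_def sup_le_bot_type_def
      certified typecheck cong: typecheck_cong)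

declare sup_le_bot_type_def [certified]

definition not_not_lem_type :: "nat \<Rightarrow> tm" where
  "not_not_lem_type v = Pi (Univ v) (neg (neg (Trunc (dec (Var 0)))))"

(* k |-> k (inr (q |-> k (inl q))) *)
definition not_not_lem :: "nat \<Rightarrow> tm" where
  "not_not_lem v = asc (not_not_lem_type v)
    (Lam (Lam (Var 0 \<cdot> TrIn (InR (Lam (Var 1 \<cdot> TrIn (InL (Var 0))))))))"

lemma not_not_lem_closed [certified]:
  "rename r (not_not_lem v) = not_not_lem v"
  "subst s (not_not_lem v) = not_not_lem v"
  "lam_of (not_not_lem v) = None"
  by (simp_all only: not_not_lem_def not_not_lem_type_def certified typecheck)

lemma run_not_not_lem [certified]:
  "run layer2 m \<Gamma> (not_not_lem v) =
    accept layer2 m \<Gamma> (Some (not_not_lem_type v))"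
  by (simp only: not_not_lem_def not_not_lem_type_def
      certified typecheck cong: typecheck_cong)

declare not_not_lem_type_def [certified]

definition em_of_stable_type :: "nat \<Rightarrow> nat \<Rightarrow> nat \<Rightarrow> tm" where
  "em_of_stable_type v u t =
    delta_posets v u t
      (Pi (positive v (Var 3) (Var 2) (Var 1) (Var 0))
         (stable_equality (Var 4) \<rightarrow> excluded_middle v))"

(* With P = Trunc (dec Q) and s = sup (delta x y P), the strictness of x below y is applied to z = y
   and to the equation y = s, which holds by stability since P implies it and P is not false.
   Variables: X = 7, R = 6, ax = 5, c = 4, pos = 3, st = 2, Q = 1. *)
definition em_of_stable :: "nat \<Rightarrow> nat \<Rightarrow> nat \<Rightarrow> tm" where
  "em_of_stable v u t = asc (em_of_stable_type v u t)
    (lams 8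
       (Proj2 (Proj2 (Proj2 (Var 3))) \<cdot> Proj1 (Proj2 (Var 3)) \<cdot>
          (poset_refl (Var 5) \<cdot> Proj1 (Proj2 (Var 3))) \<cdot> Trunc (dec (Var 1)) \<cdot> trunc_is_prop \<cdot>
          (Var 2 \<cdot> Proj1 (Proj2 (Var 3)) \<cdot>
             delta_sup (Var 4) (Proj1 (Var 3)) (Proj1 (Proj2 (Var 3)))
               (poset_trans (Var 5) \<cdot> Proj1 (Var 3) \<cdot> Proj1 (Proj2 (Var 3)) \<cdot>
                  Proj1 (Proj2 (Var 3)) \<cdot> Proj1 (Proj2 (Proj2 (Var 3))) \<cdot>
                  (poset_refl (Var 5) \<cdot> Proj1 (Proj2 (Var 3)))) (Trunc (dec (Var 1)))
               trunc_is_prop \<cdot>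
             Lam
               (not_not_lem v \<cdot> Var 2 \<cdot>
                  Lam
                    (Var 1 \<cdot>
                       (sup_eq_top v u t \<cdot> Var 9 \<cdot> Var 8 \<cdot> Var 7 \<cdot> Var 6 \<cdot> Proj1 (Var 5) \<cdot>
                          Proj1 (Proj2 (Var 5)) \<cdot>
                          (poset_trans (Var 7) \<cdot> Proj1 (Var 5) \<cdot> Proj1 (Proj2 (Var 5)) \<cdot>
                             Proj1 (Proj2 (Var 5)) \<cdot> Proj1 (Proj2 (Proj2 (Var 5))) \<cdot>
                             (poset_refl (Var 7) \<cdot> Proj1 (Proj2 (Var 5)))) \<cdot>
                          Trunc (dec (Var 3)) \<cdot> trunc_is_prop \<cdot> Var 0))))))"

lemma em_of_stable_closed [certified]:
  "rename r (em_of_stable v u t) = em_of_stable v u t"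
  "subst s (em_of_stable v u t) = em_of_stable v u t"
  "lam_of (em_of_stable v u t) = None"
  by (simp_all only: em_of_stable_def em_of_stable_type_def certified typecheck)

lemma run_em_of_stable [certified]:
  "run layer2 m \<Gamma> (em_of_stable v u t) =
    accept layer2 m \<Gamma> (Some (em_of_stable_type v u t))"
  by (simp only: em_of_stable_def em_of_stable_type_def
      certified typecheck cong: typecheck_cong)

declare em_of_stable_type_def [certified]


section \<open>Completeness and positivity from excluded middle\<close>

text \<open>Two proofs of \<open>P\<close> are equal by hypothesis, two refutations by function
  extensionality.\<close>

definition dec_is_prop_type :: "nat \<Rightarrow> tm" where
  "dec_is_prop_type v = Pi (Univ v) (is_prop (Var 0) \<rightarrow> is_prop (dec (Var 0)))"

(* Equal constructors are compared by J, distinct ones are excluded by the negated summand. *)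
definition dec_is_prop :: "nat \<Rightarrow> tm" where
  "dec_is_prop v = asc (dec_is_prop_type v)
    (lams 4
       (CaseOf (Pi (dec (Var 4)) (Eq (dec (Var 5)) (Var 1) (Var 0)))
          (Lam
             (CaseOf (Eq (dec (Var 6)) (InL (Var 2)) (Var 0))
                (J (Var 6) (Var 2) (Eq (dec (Var 8)) (InL (Var 4)) (InL (Var 1)))
                   (Rfl (InL (Var 2))) (Var 0) (Var 5 \<cdot> Var 2 \<cdot> Var 0))
                (Abort (Eq (dec (Var 7)) (InL (Var 3)) (InR (Var 1))) (Var 0 \<cdot> Var 2))
                (Var 0)))
          (Lam
             (CaseOf (Eq (dec (Var 6)) (InR (Var 2)) (Var 0))
                (Abort (Eq (dec (Var 7)) (InR (Var 3)) (InL (Var 1))) (Var 2 \<cdot> Var 0))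
                (J (neg (Var 6)) (Var 2) (Eq (dec (Var 8)) (InR (Var 4)) (InR (Var 1)))
                   (Rfl (InR (Var 2))) (Var 0)
                   (Funext (Var 2) (Var 0)
                      (Lam
                         (Abort (Eq (Empty 0) (Var 4 \<cdot> Var 1) (Var 2 \<cdot> Var 1))
                            (Var 3 \<cdot> Var 0))))) (Var 0))) (Var 1) \<cdot> Var 0))"

lemma dec_is_prop_closed [certified]:
  "rename r (dec_is_prop v) = dec_is_prop v"
  "subst s (dec_is_prop v) = dec_is_prop v"
  "lam_of (dec_is_prop v) = None"
  by (simp_all only: dec_is_prop_def dec_is_prop_type_def certified typecheck)

lemma run_dec_is_prop [certified]:
  "run layer2 m \<Gamma> (dec_is_prop v) =
    accept layer2 m \<Gamma> (Some (dec_is_prop_type v))"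
  by (simp only: dec_is_prop_def dec_is_prop_type_def
      certified typecheck cong: typecheck_cong)

declare dec_is_prop_type_def [certified]

text \<open>\<open>TrRec\<close> only maps into propositions. As \<open>dec P\<close> is one when
  \<open>P\<close> is, the truncation is removed here, and later terms can choose an element or
  prove \<open>P\<close> by a plain \<open>CaseOf\<close>.\<close>

definition decide_type :: "nat \<Rightarrow> tm" where
  "decide_type v =
    excluded_middle v \<rightarrow> Pi (Univ v) (is_prop (Var 0) \<rightarrow> dec (Var 0))"

definition decide :: "nat \<Rightarrow> tm" where
  "decide v = asc (decide_type v)
    (lams 3
       (TrRec (dec (Var 1)) (dec_is_prop v \<cdot> Var 1 \<cdot> Var 0) (Lam (Var 0))
          (Var 2 \<cdot> Var 1 \<cdot> Var 0)))"

lemma decide_closed [certified]: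
  "rename r (decide v) = decide v"
  "subst s (decide v) = decide v"
  "lam_of (decide v) = None"
  by (simp_all only: decide_def decide_type_def certified typecheck)

lemma run_decide [certified]:
  "run layer2 m \<Gamma> (decide v) =
    accept layer2 m \<Gamma> (Some (decide_type v))"
  by (simp only: decide_def decide_type_def
      certified typecheck cong: typecheck_cong)

declare decide_type_def [certified]

definition em_complete_type :: "nat \<Rightarrow> nat \<Rightarrow> nat \<Rightarrow> tm" where
  "em_complete_type v u t =
    Pi (excluded_middle v) (posets u t (delta_complete v (Var 2) (Var 1)))"

(* In the case analysis: E = 8, X = 7, R = 6, ax = 5, x = 4, y = 3, l = 2, P = 1, h = 0. *)
definition em_complete :: "nat \<Rightarrow> nat \<Rightarrow> nat \<Rightarrow> tm" where
  "em_complete v u t = asc (em_complete_type v u t)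
    (lams 9
       (CaseOf
          (has_sup (Var 8) (Var 7) (delta_index v (Var 2)) (delta (Var 8) (Var 5) (Var 4)))
          (Tup (Var 4)
             (Tup
                (Lam
                   (CaseOf (Var 9 \<cdot> (delta (Var 10) (Var 7) (Var 6) \<cdot> Var 0) \<cdot> Var 6) (Var 5)
                      (poset_refl (Var 8) \<cdot> Var 6) (Var 0)))
                (Lam (Lam (Var 0 \<cdot> InR (Var 2))))))
          (Tup (Var 5)
             (Tup
                (Lam
                   (CaseOf (Var 9 \<cdot> (delta (Var 10) (Var 7) (Var 6) \<cdot> Var 0) \<cdot> Var 7)
                      (poset_refl (Var 8) \<cdot> Var 7)
                      (Abort (Var 10 \<cdot> Var 7 \<cdot> Var 8) (Var 2 \<cdot> Var 0)) (Var 0)))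
                (Lam (Lam (Var 0 \<cdot> InL (Star v)))))) (decide v \<cdot> Var 8 \<cdot> Var 1 \<cdot> Var 0)))"

lemma em_complete_closed [certified]:
  "rename r (em_complete v u t) = em_complete v u t"
  "subst s (em_complete v u t) = em_complete v u t"
  "lam_of (em_complete v u t) = None"
  by (simp_all only: em_complete_def em_complete_type_def certified typecheck)

lemma run_em_complete [certified]:
  "run layer2 m \<Gamma> (em_complete v u t) =
    accept layer2 m \<Gamma> (Some (em_complete_type v u t))"
  by (simp only: em_complete_def em_complete_type_def
      certified typecheck cong: typecheck_cong)

declare em_complete_type_def [certified]

text \<open>The completeness structure is a variable: suprema enter through their universal
  property, so \<open>em_complete\<close> stays folded.\<close>

definition em_strictly_below_type :: "nat \<Rightarrow> nat \<Rightarrow> nat \<Rightarrow> tm" where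
  "em_strictly_below_type v u t =
    Pi (excluded_middle v)
      (delta_posets v u t
         (Pi (Var 3)
            (Pi (Var 4)
               (Var 4 \<cdot> Var 1 \<cdot> Var 0 \<rightarrow> neg (Var 4 \<cdot> Var 0 \<cdot> Var 1) \<rightarrow>
                strictly_below v (Var 5) (Var 4) (Var 3) (Var 2) (Var 1) (Var 0)))))"

(* If P fails, then x is an upper bound of delta x z P, so z = sup (delta x z P) <= x; together with
   y <= z this contradicts the assumption neg (y <= x). The equation e : z = sup (delta x z P) is
   used by J with motive b |-> (b <= x -> z <= x). *)
definition em_strictly_below :: "nat \<Rightarrow> nat \<Rightarrow> nat \<Rightarrow> tm" where
  "em_strictly_below v u t = asc (em_strictly_below_type v u t)
    (lams 9
       (Tup (Var 1)
          (lams 5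
             (CaseOf (Var 3) (Var 0)
                (Abort (Var 4)
                   (Var 6 \<cdot>
                      (poset_trans (Var 11) \<cdot> Var 8 \<cdot> Var 5 \<cdot> Var 9 \<cdot> Var 4 \<cdot>
                         (J (Var 13) (Var 5)
                            (Var 14 \<cdot> Var 1 \<cdot> Var 11 \<rightarrow> Var 14 \<cdot> Var 7 \<cdot> Var 11) (Lam (Var 0))
                            (delta_sup (Var 10) (Var 9) (Var 5)
                               (poset_trans (Var 11) \<cdot> Var 9 \<cdot> Var 8 \<cdot> Var 5 \<cdot> Var 7 \<cdot> Var 4)
                               (Var 3) (Var 2)) (Var 1) \<cdot>
                            (sup_le_bot v u t \<cdot> Var 13 \<cdot> Var 12 \<cdot> Var 11 \<cdot> Var 10 \<cdot> Var 9 \<cdot>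
                               Var 5 \<cdot>
                               (poset_trans (Var 11) \<cdot> Var 9 \<cdot> Var 8 \<cdot> Var 5 \<cdot> Var 7 \<cdot> Var 4) \<cdot>
                               Var 3 \<cdot> Var 2 \<cdot> Var 0)))))
                (decide v \<cdot> Var 13 \<cdot> Var 2 \<cdot> Var 1)))))"

lemma em_strictly_below_closed [certified]:
  "rename r (em_strictly_below v u t) = em_strictly_below v u t"
  "subst s (em_strictly_below v u t) = em_strictly_below v u t"
  "lam_of (em_strictly_below v u t) = None"
  by (simp_all only: em_strictly_below_def em_strictly_below_type_def certified typecheck)

lemma run_em_strictly_below [certified]:
  "run layer2 m \<Gamma> (em_strictly_below v u t) =
    accept layer2 m \<Gamma> (Some (em_strictly_below_type v u t))"
  by (simp only: em_strictly_below_def em_strictly_below_type_def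
      certified typecheck cong: typecheck_cong)

declare em_strictly_below_type_def [certified]


section \<open>The two-element poset\<close>

abbreviation two :: tm where
  "two \<equiv> Coprod (Unit 0) (Unit 0)"

(* The order on two has bottom InL and top InR: a <= b means fibre a -> fibre b. *)
abbreviation fibre :: "nat \<Rightarrow> tm \<Rightarrow> tm" where
  "fibre v a \<equiv> CaseOf (Univ v) (Empty v) (Unit v) a"

text \<open>With this order, reflexivity is the identity and transitivity is composition. The inner
  \<open>asc\<close> is there for reduction: contracting the outer redex synthesizes the type of its
  body, and a bare \<open>Lam\<close> has none to offer.\<close>

definition two_le_body :: "nat \<Rightarrow> tm" where
  "two_le_body v =
    Lam (asc (two \<rightarrow> Univ v) (Lam (fibre v (Var 1) \<rightarrow> fibre v (Var 0))))"

definition two_le_type :: "nat \<Rightarrow> tm" where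
  "two_le_type v = two \<rightarrow> two \<rightarrow> Univ v"

definition two_le :: "nat \<Rightarrow> tm" where
  "two_le v = asc (two_le_type v) (two_le_body v)"

lemma two_le_closed [certified]:
  "rename r (two_le v) = two_le v"
  "subst s (two_le v) = two_le v"
  "lam_of (two_le v) = None"
  by (simp_all only: two_le_def two_le_body_def two_le_type_def certified typecheck)

lemma run_two_le [certified]:
  "run layer2 m \<Gamma> (two_le v) =
    accept layer2 m \<Gamma> (Some (two_le_type v))"
  by (simp only: two_le_def two_le_type_def two_le_body_def certified typecheck
      cong: typecheck_cong)

declare two_le_type_def [certified]

text \<open>The order is the only constant that conversion has to unfold, and conversion runs one layer down.\<close>

lemma layer1_two_le [certified]:
  "run layer1 m \<Gamma> (two_le v) = accept layer1 m \<Gamma> (Some (two_le_type v))"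
  "red layer1 \<Gamma> (two_le v) = Some (two_le_body v, two_le_type v)"
  by (simp_all only: two_le_def two_le_body_def certified typecheck cong: typecheck_cong)

declare two_le_body_def [certified]

definition two_le_dest_type :: "nat \<Rightarrow> tm" where
  "two_le_dest_type v =
    Pi two (Pi two (two_le v \<cdot> Var 1 \<cdot> Var 0 \<rightarrow> fibre v (Var 1) \<rightarrow> fibre v (Var 0)))"

text \<open>An identity function whose typing is the conversion that unfolds the order. It is
  checked once, at variables; its instances at constructors then match by substitution
  alone.\<close>

definition two_le_dest :: "nat \<Rightarrow> tm" where
  "two_le_dest v = asc (two_le_dest_type v) (lams 3 (Var 0))"

lemma two_le_dest_closed [certified]:
  "rename r (two_le_dest v) = two_le_dest v"
  "subst s (two_le_dest v) = two_le_dest v"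
  "lam_of (two_le_dest v) = None"
  by (simp_all only: two_le_dest_def two_le_dest_type_def certified typecheck)

lemma run_two_le_dest [certified]:
  "run layer2 m \<Gamma> (two_le_dest v) =
    accept layer2 m \<Gamma> (Some (two_le_dest_type v))"
  by (simp only: two_le_dest_def two_le_dest_type_def
      certified typecheck cong: typecheck_cong)

declare two_le_dest_type_def [certified]

definition two_le_intro_type :: "nat \<Rightarrow> tm" where
  "two_le_intro_type v =
    Pi two (Pi two ((fibre v (Var 1) \<rightarrow> fibre v (Var 0)) \<rightarrow> two_le v \<cdot> Var 1 \<cdot> Var 0))"

definition two_le_intro :: "nat \<Rightarrow> tm" where
  "two_le_intro v = asc (two_le_intro_type v) (lams 3 (Var 0))"

lemma two_le_intro_closed [certified]:
  "rename r (two_le_intro v) = two_le_intro v"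
  "subst s (two_le_intro v) = two_le_intro v"
  "lam_of (two_le_intro v) = None"
  by (simp_all only: two_le_intro_def two_le_intro_type_def certified typecheck)

lemma run_two_le_intro [certified]:
  "run layer2 m \<Gamma> (two_le_intro v) =
    accept layer2 m \<Gamma> (Some (two_le_intro_type v))"
  by (simp only: two_le_intro_def two_le_intro_type_def
      certified typecheck cong: typecheck_cong)

declare two_le_intro_type_def [certified]

section \<open>The fibres at bottom and top, and their propositionality\<close>

definition fibre_inl_type :: "nat \<Rightarrow> tm" where
  "fibre_inl_type v = Pi (Unit 0) (fibre v (InL (Var 0)) \<rightarrow> Empty v)"

definition fibre_inl :: "nat \<Rightarrow> tm" where
  "fibre_inl v = asc (fibre_inl_type v) (Lam (Lam (Var 0)))"

lemma fibre_inl_closed [certified]: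
  "rename r (fibre_inl v) = fibre_inl v"
  "subst s (fibre_inl v) = fibre_inl v"
  "lam_of (fibre_inl v) = None"
  by (simp_all only: fibre_inl_def fibre_inl_type_def certified typecheck)

lemma run_fibre_inl [certified]:
  "run layer2 m \<Gamma> (fibre_inl v) =
    accept layer2 m \<Gamma> (Some (fibre_inl_type v))"
  by (simp only: fibre_inl_def fibre_inl_type_def
      certified typecheck cong: typecheck_cong)

declare fibre_inl_type_def [certified]

definition fibre_inr_type :: "nat \<Rightarrow> tm" where
  "fibre_inr_type v = Pi (Unit 0) (fibre v (InR (Var 0)))"

definition fibre_inr :: "nat \<Rightarrow> tm" where
  "fibre_inr v = asc (fibre_inr_type v) (Lam (Star v))"

lemma fibre_inr_closed [certified]:
  "rename r (fibre_inr v) = fibre_inr v"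
  "subst s (fibre_inr v) = fibre_inr v"
  "lam_of (fibre_inr v) = None"
  by (simp_all only: fibre_inr_def fibre_inr_type_def certified typecheck)

lemma run_fibre_inr [certified]:
  "run layer2 m \<Gamma> (fibre_inr v) =
    accept layer2 m \<Gamma> (Some (fibre_inr_type v))"
  by (simp only: fibre_inr_def fibre_inr_type_def
      certified typecheck cong: typecheck_cong)

declare fibre_inr_type_def [certified]

definition empty_is_prop_type :: "nat \<Rightarrow> tm" where
  "empty_is_prop_type v = is_prop (Empty v)"

definition empty_is_prop :: "nat \<Rightarrow> tm" where
  "empty_is_prop v = asc (empty_is_prop_type v)
    (Lam (Lam (Abort (Eq (Empty v) (Var 2) (Var 1)) (Var 1))))"

lemma empty_is_prop_closed [certified]:
  "rename r (empty_is_prop v) = empty_is_prop v"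
  "subst s (empty_is_prop v) = empty_is_prop v"
  "lam_of (empty_is_prop v) = None"
  by (simp_all only: empty_is_prop_def empty_is_prop_type_def certified typecheck)

lemma run_empty_is_prop [certified]:
  "run layer2 m \<Gamma> (empty_is_prop v) =
    accept layer2 m \<Gamma> (Some (empty_is_prop_type v))"
  by (simp only: empty_is_prop_def empty_is_prop_type_def
      certified typecheck cong: typecheck_cong)

declare empty_is_prop_type_def [certified]

definition unit_is_prop_type :: "nat \<Rightarrow> tm" where
  "unit_is_prop_type v = is_prop (Unit v)"

definition unit_is_prop :: "nat \<Rightarrow> tm" where
  "unit_is_prop v = asc (unit_is_prop_type v)
    (Lam
       (Lam
          (UnitRec (Eq (Unit v) (Var 0) (Var 1))
             (UnitRec (Eq (Unit v) (Star v) (Var 0)) (Rfl (Star v)) (Var 0)) (Var 1))))"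

lemma unit_is_prop_closed [certified]:
  "rename r (unit_is_prop v) = unit_is_prop v"
  "subst s (unit_is_prop v) = unit_is_prop v"
  "lam_of (unit_is_prop v) = None"
  by (simp_all only: unit_is_prop_def unit_is_prop_type_def certified typecheck)

lemma run_unit_is_prop [certified]:
  "run layer2 m \<Gamma> (unit_is_prop v) =
    accept layer2 m \<Gamma> (Some (unit_is_prop_type v))"
  by (simp only: unit_is_prop_def unit_is_prop_type_def
      certified typecheck cong: typecheck_cong)

declare unit_is_prop_type_def [certified]

definition fibre_is_prop_type :: "nat \<Rightarrow> tm" where
  "fibre_is_prop_type v = Pi two (is_prop (fibre v (Var 0)))"

definition fibre_is_prop :: "nat \<Rightarrow> tm" where
  "fibre_is_prop v = asc (fibre_is_prop_type v)
    (Lam (CaseOf (is_prop (fibre v (Var 0))) (empty_is_prop v) (unit_is_prop v) (Var 0)))"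

lemma fibre_is_prop_closed [certified]:
  "rename r (fibre_is_prop v) = fibre_is_prop v"
  "subst s (fibre_is_prop v) = fibre_is_prop v"
  "lam_of (fibre_is_prop v) = None"
  by (simp_all only: fibre_is_prop_def fibre_is_prop_type_def certified typecheck)

lemma run_fibre_is_prop [certified]:
  "run layer2 m \<Gamma> (fibre_is_prop v) =
    accept layer2 m \<Gamma> (Some (fibre_is_prop_type v))"
  by (simp only: fibre_is_prop_def fibre_is_prop_type_def
      certified typecheck cong: typecheck_cong)

declare fibre_is_prop_type_def [certified]

definition fibre_arrow_is_prop_type :: "nat \<Rightarrow> tm" where
  "fibre_arrow_is_prop_type v =
    Pi two (Pi two (is_prop (fibre v (Var 1) \<rightarrow> fibre v (Var 0))))"

definition fibre_arrow_is_prop :: "nat \<Rightarrow> tm" where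
  "fibre_arrow_is_prop v = asc (fibre_arrow_is_prop_type v)
    (lams 4
       (Funext (Var 1) (Var 0)
          (Lam (fibre_is_prop v \<cdot> Var 3 \<cdot> (Var 2 \<cdot> Var 0) \<cdot> (Var 1 \<cdot> Var 0)))))"

lemma fibre_arrow_is_prop_closed [certified]:
  "rename r (fibre_arrow_is_prop v) = fibre_arrow_is_prop v"
  "subst s (fibre_arrow_is_prop v) = fibre_arrow_is_prop v"
  "lam_of (fibre_arrow_is_prop v) = None"
  by (simp_all only: fibre_arrow_is_prop_def fibre_arrow_is_prop_type_def certified typecheck)

lemma run_fibre_arrow_is_prop [certified]:
  "run layer2 m \<Gamma> (fibre_arrow_is_prop v) =
    accept layer2 m \<Gamma> (Some (fibre_arrow_is_prop_type v))"
  by (simp only: fibre_arrow_is_prop_def fibre_arrow_is_prop_type_def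
      certified typecheck cong: typecheck_cong)

declare fibre_arrow_is_prop_type_def [certified]

definition two_top_not_le_type :: "nat \<Rightarrow> tm" where
  "two_top_not_le_type v =
    Pi (Unit 0) (Pi (Unit 0) (neg (two_le v \<cdot> InR (Var 1) \<cdot> InL (Var 0))))"

text \<open>The order would send the element of the top fibre into the empty bottom fibre. That
  contradiction lies in \<open>Empty v\<close>, while \<open>neg\<close> targets
  \<open>Empty 0\<close>; universes are not cumulative, hence the \<open>Abort\<close>.\<close>

definition two_top_not_le :: "nat \<Rightarrow> tm" where
  "two_top_not_le v = asc (two_top_not_le_type v)
    (lams 3
       (Abort (Empty 0)
          (fibre_inl v \<cdot> Var 1 \<cdot>
             (two_le_dest v \<cdot> InR (Var 2) \<cdot> InL (Var 1) \<cdot> Var 0 \<cdot> (fibre_inr v \<cdot> Var 2)))))"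

lemma two_top_not_le_closed [certified]:
  "rename r (two_top_not_le v) = two_top_not_le v"
  "subst s (two_top_not_le v) = two_top_not_le v"
  "lam_of (two_top_not_le v) = None"
  by (simp_all only: two_top_not_le_def two_top_not_le_type_def certified typecheck)

lemma run_two_top_not_le [certified]:
  "run layer2 m \<Gamma> (two_top_not_le v) =
    accept layer2 m \<Gamma> (Some (two_top_not_le_type v))"
  by (simp only: two_top_not_le_def two_top_not_le_type_def
      certified typecheck cong: typecheck_cong)

declare two_top_not_le_type_def [certified]

text \<open>The unit type has no judgemental uniqueness rule, so distinct variables under
  \<open>InL\<close> are identified only propositionally, by recursion on both.\<close>

definition two_inl_eq_type :: "tm" where
  "two_inl_eq_type = Pi (Unit 0) (Pi (Unit 0) (Eq two (InL (Var 1)) (InL (Var 0))))"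

definition two_inl_eq :: "tm" where
  "two_inl_eq = asc two_inl_eq_type
    (Lam
       (Lam
          (UnitRec (Eq two (InL (Var 0)) (InL (Var 1)))
             (UnitRec (Eq two (InL (Star 0)) (InL (Var 0))) (Rfl (InL (Star 0))) (Var 0))
             (Var 1))))"

lemma two_inl_eq_closed [certified]:
  "rename r two_inl_eq = two_inl_eq"
  "subst s two_inl_eq = two_inl_eq"
  "lam_of two_inl_eq = None"
  by (simp_all only: two_inl_eq_def two_inl_eq_type_def certified typecheck)

lemma run_two_inl_eq [certified]:
  "run layer2 m \<Gamma> two_inl_eq =
    accept layer2 m \<Gamma> (Some two_inl_eq_type)"
  by (simp only: two_inl_eq_def two_inl_eq_type_def
      certified typecheck cong: typecheck_cong)

declare two_inl_eq_type_def [certified]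

definition two_inr_eq_type :: "tm" where
  "two_inr_eq_type = Pi (Unit 0) (Pi (Unit 0) (Eq two (InR (Var 1)) (InR (Var 0))))"

definition two_inr_eq :: "tm" where
  "two_inr_eq = asc two_inr_eq_type
    (Lam
       (Lam
          (UnitRec (Eq two (InR (Var 0)) (InR (Var 1)))
             (UnitRec (Eq two (InR (Star 0)) (InR (Var 0))) (Rfl (InR (Star 0))) (Var 0))
             (Var 1))))"

lemma two_inr_eq_closed [certified]:
  "rename r two_inr_eq = two_inr_eq"
  "subst s two_inr_eq = two_inr_eq"
  "lam_of two_inr_eq = None"
  by (simp_all only: two_inr_eq_def two_inr_eq_type_def certified typecheck)

lemma run_two_inr_eq [certified]:
  "run layer2 m \<Gamma> two_inr_eq =
    accept layer2 m \<Gamma> (Some two_inr_eq_type)"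
  by (simp only: two_inr_eq_def two_inr_eq_type_def
      certified typecheck cong: typecheck_cong)

declare two_inr_eq_type_def [certified]

definition two_refl_type :: "nat \<Rightarrow> tm" where
  "two_refl_type v = reflexive two (two_le v)"

definition two_refl :: "nat \<Rightarrow> tm" where
  "two_refl v = asc (two_refl_type v)
    (Lam (two_le_intro v \<cdot> Var 0 \<cdot> Var 0 \<cdot> Lam (Var 0)))"

lemma two_refl_closed [certified]:
  "rename r (two_refl v) = two_refl v"
  "subst s (two_refl v) = two_refl v"
  "lam_of (two_refl v) = None"
  by (simp_all only: two_refl_def two_refl_type_def certified typecheck)

lemma run_two_refl [certified]:
  "run layer2 m \<Gamma> (two_refl v) =
    accept layer2 m \<Gamma> (Some (two_refl_type v))"
  by (simp only: two_refl_def two_refl_type_def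
      certified typecheck cong: typecheck_cong)

declare two_refl_type_def [certified]

text \<open>The order is proposition-valued by \<open>fibre_arrow_is_prop\<close> up to conversion.
  \<open>is_prop\<close> mentions the order three times; since a parallel step rewrites all
  occurrences, the bound variables keep exactly the type of the equation between them, as the
  \<open>Eq\<close> clause of \<open>red\<close> demands. In each mixed case of antisymmetry, one
  hypothesis puts the top below the bottom.\<close>

definition two_poset_type :: "nat \<Rightarrow> tm" where
  "two_poset_type v = poset_axioms two (two_le v)"

definition two_poset :: "nat \<Rightarrow> tm" where
  "two_poset v = asc (two_poset_type v)
    (Tup (Lam (Lam (fibre_arrow_is_prop v \<cdot> Var 1 \<cdot> Var 0)))
       (Tup (two_refl v)
          (Tup
             (lams 5
                (two_le_intro v \<cdot> Var 4 \<cdot> Var 2 \<cdot>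
                   Lam
                     (two_le_dest v \<cdot> Var 4 \<cdot> Var 3 \<cdot> Var 1 \<cdot>
                        (two_le_dest v \<cdot> Var 5 \<cdot> Var 4 \<cdot> Var 2 \<cdot> Var 0))))
             (Lam
                (CaseOf
                   (Pi two
                      (two_le v \<cdot> Var 1 \<cdot> Var 0 \<rightarrow> two_le v \<cdot> Var 0 \<cdot> Var 1 \<rightarrow>
                       Eq two (Var 1) (Var 0)))
                   (Lam
                      (CaseOf
                         (two_le v \<cdot> InL (Var 2) \<cdot> Var 0 \<rightarrow> two_le v \<cdot> Var 0 \<cdot> InL (Var 2) \<rightarrow>
                          Eq two (InL (Var 2)) (Var 0))
                         (Lam (Lam (two_inl_eq \<cdot> Var 4 \<cdot> Var 2)))
                         (Lam
                            (Lam
                               (Abort (Eq two (InL (Var 5)) (InR (Var 3)))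
                                  (two_top_not_le v \<cdot> Var 2 \<cdot> Var 4 \<cdot> Var 0)))) (Var 0)))
                   (Lam
                      (CaseOf
                         (two_le v \<cdot> InR (Var 2) \<cdot> Var 0 \<rightarrow> two_le v \<cdot> Var 0 \<cdot> InR (Var 2) \<rightarrow>
                          Eq two (InR (Var 2)) (Var 0))
                         (Lam
                            (Lam
                               (Abort (Eq two (InR (Var 5)) (InL (Var 3)))
                                  (two_top_not_le v \<cdot> Var 4 \<cdot> Var 2 \<cdot> Var 1))))
                         (Lam (Lam (two_inr_eq \<cdot> Var 4 \<cdot> Var 2))) (Var 0))) (Var 0))))))"

lemma two_poset_closed [certified]:
  "rename r (two_poset v) = two_poset v"
  "subst s (two_poset v) = two_poset v"
  "lam_of (two_poset v) = None"
  by (simp_all only: two_poset_def two_poset_type_def certified typecheck)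

lemma run_two_poset [certified]:
  "run layer2 m \<Gamma> (two_poset v) =
    accept layer2 m \<Gamma> (Some (two_poset_type v))"
  by (simp only: two_poset_def two_poset_type_def
      certified typecheck cong: typecheck_cong)

declare two_poset_type_def [certified]

definition two_decidable_type :: "nat \<Rightarrow> tm" where
  "two_decidable_type v = decidable_equality two"

(* An equation e between inl and inr would give inr <= inl, by transporting reflexivity along e. *)
definition two_decidable :: "nat \<Rightarrow> tm" where
  "two_decidable v = asc (two_decidable_type v)
    (Lam
       (CaseOf (Pi two (dec (Eq two (Var 1) (Var 0))))
          (Lam
             (CaseOf (dec (Eq two (InL (Var 2)) (Var 0))) (InL (two_inl_eq \<cdot> Var 2 \<cdot> Var 0))
                (InR
                   (Lam
                      (two_top_not_le v \<cdot> Var 1 \<cdot> Var 3 \<cdot>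
                         J two (InL (Var 3)) (two_le v \<cdot> Var 1 \<cdot> InL (Var 5))
                           (two_refl v \<cdot> InL (Var 3)) (InR (Var 1)) (Var 0)))) (Var 0)))
          (Lam
             (CaseOf (dec (Eq two (InR (Var 2)) (Var 0)))
                (InR
                   (Lam
                      (two_top_not_le v \<cdot> Var 3 \<cdot> Var 1 \<cdot>
                         J two (InR (Var 3)) (two_le v \<cdot> InR (Var 5) \<cdot> Var 1)
                           (two_refl v \<cdot> InR (Var 3)) (InL (Var 1)) (Var 0))))
                (InL (two_inr_eq \<cdot> Var 2 \<cdot> Var 0)) (Var 0))) (Var 0)))"

lemma two_decidable_closed [certified]:
  "rename r (two_decidable v) = two_decidable v"
  "subst s (two_decidable v) = two_decidable v"
  "lam_of (two_decidable v) = None"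
  by (simp_all only: two_decidable_def two_decidable_type_def certified typecheck)

lemma run_two_decidable [certified]:
  "run layer2 m \<Gamma> (two_decidable v) =
    accept layer2 m \<Gamma> (Some (two_decidable_type v))"
  by (simp only: two_decidable_def two_decidable_type_def
      certified typecheck cong: typecheck_cong)

declare two_decidable_type_def [certified]

definition id_equivalence_type :: "nat \<Rightarrow> tm" where
  "id_equivalence_type v = Pi (Univ v) (equivalence (Var 0) (Var 0))"

definition id_equivalence :: "nat \<Rightarrow> tm" where
  "id_equivalence v = asc (id_equivalence_type v)
    (Lam
       (Tup (Lam (Var 0))
          (Tup (Tup (Lam (Var 0)) (Lam (Rfl (Var 0))))
             (Tup (Lam (Var 0)) (Lam (Rfl (Var 0)))))))"

lemma id_equivalence_closed [certified]:
  "rename r (id_equivalence v) = id_equivalence v"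
  "subst s (id_equivalence v) = id_equivalence v"
  "lam_of (id_equivalence v) = None"
  by (simp_all only: id_equivalence_def id_equivalence_type_def certified typecheck)

lemma run_id_equivalence [certified]:
  "run layer2 m \<Gamma> (id_equivalence v) =
    accept layer2 m \<Gamma> (Some (id_equivalence_type v))"
  by (simp only: id_equivalence_def id_equivalence_type_def
      certified typecheck cong: typecheck_cong)

declare id_equivalence_type_def [certified]

definition two_small_type :: "nat \<Rightarrow> tm" where
  "two_small_type v = locally_small v two (two_le v)"

text \<open>The order already takes values in \<open>Univ v\<close>, so it is its own small
  version.\<close>

definition two_small :: "nat \<Rightarrow> tm" where
  "two_small v = asc (two_small_type v)
    (Tup (two_le v) (Lam (Lam (id_equivalence v \<cdot> (two_le v \<cdot> Var 1 \<cdot> Var 0)))))"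

lemma two_small_closed [certified]:
  "rename r (two_small v) = two_small v"
  "subst s (two_small v) = two_small v"
  "lam_of (two_small v) = None"
  by (simp_all only: two_small_def two_small_type_def certified typecheck)

lemma run_two_small [certified]:
  "run layer2 m \<Gamma> (two_small v) =
    accept layer2 m \<Gamma> (Some (two_small_type v))"
  by (simp only: two_small_def two_small_type_def
      certified typecheck cong: typecheck_cong)

declare two_small_type_def [certified]

section \<open>The three implications as closed terms\<close>

text \<open>The tuple is assembled over variables and instantiated afterwards, which keeps the
  two-element order out of the types against which its components are checked.\<close>

definition em_poset_type :: "nat \<Rightarrow> nat \<Rightarrow> nat \<Rightarrow> tm" where
  "em_poset_type v u t =
    Pi (excluded_middle v)
      (delta_posets v u t
         (Pi (Var 3)
            (Pi (Var 4)
               (Var 4 \<cdot> Var 1 \<cdot> Var 0 \<rightarrow> neg (Var 4 \<cdot> Var 0 \<cdot> Var 1) \<rightarrow>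
                locally_small v (Var 5) (Var 4) \<rightarrow> decidable_equality (Var 5) \<rightarrow>
                positive_poset decidable_equality v u t))))"

definition em_poset :: "nat \<Rightarrow> nat \<Rightarrow> nat \<Rightarrow> tm" where
  "em_poset v u t = asc (em_poset_type v u t)
    (lams 11
       (Tup (Var 9)
          (Tup (Var 8)
             (Tup (Var 7)
                (Tup (Var 6)
                   (Tup
                      (Tup (Var 5)
                         (Tup (Var 4)
                            (em_strictly_below v u t \<cdot> Var 10 \<cdot> Var 9 \<cdot> Var 8 \<cdot> Var 7 \<cdot> Var 6 \<cdot>
                               Var 5 \<cdot> Var 4 \<cdot> Var 3 \<cdot> Var 2))) (Tup (Var 1) (Var 0))))))))"

lemma em_poset_closed [certified]:
  "rename r (em_poset v u t) = em_poset v u t"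
  "subst s (em_poset v u t) = em_poset v u t"
  "lam_of (em_poset v u t) = None"
  by (simp_all only: em_poset_def em_poset_type_def certified typecheck)

lemma run_em_poset [certified]:
  "run layer2 m \<Gamma> (em_poset v u t) =
    accept layer2 m \<Gamma> (Some (em_poset_type v u t))"
  by (simp only: em_poset_def em_poset_type_def
      certified typecheck cong: typecheck_cong)

declare em_poset_type_def [certified]

text \<open>The carrier level is \<open>0\<close> because \<open>two\<close> is built from
  \<open>Unit 0\<close>; the order level is \<open>v\<close> because the fibres lie in
  \<open>Univ v\<close>.\<close>

definition decidable_of_em_type :: "nat \<Rightarrow> tm" where
  "decidable_of_em_type v =
    excluded_middle v \<rightarrow> positive_poset decidable_equality v 0 v"

definition decidable_of_em :: "nat \<Rightarrow> tm" where
  "decidable_of_em v = asc (decidable_of_em_type v)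
    (Lam
       (em_poset v 0 v \<cdot> Var 0 \<cdot> two \<cdot> two_le v \<cdot> two_poset v \<cdot>
          (em_complete v 0 v \<cdot> Var 0 \<cdot> two \<cdot> two_le v \<cdot> two_poset v) \<cdot> InL (Star 0) \<cdot>
          InR (Star 0) \<cdot>
          (two_le_intro v \<cdot> InL (Star 0) \<cdot> InR (Star 0) \<cdot> Lam (fibre_inr v \<cdot> Star 0)) \<cdot>
          (two_top_not_le v \<cdot> Star 0 \<cdot> Star 0) \<cdot> two_small v \<cdot> two_decidable v))"

lemma decidable_of_em_closed [certified]:
  "rename r (decidable_of_em v) = decidable_of_em v"
  "subst s (decidable_of_em v) = decidable_of_em v"
  "lam_of (decidable_of_em v) = None"
  by (simp_all only: decidable_of_em_def decidable_of_em_type_def certified typecheck)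

lemma run_decidable_of_em [certified]:
  "run layer2 m \<Gamma> (decidable_of_em v) =
    accept layer2 m \<Gamma> (Some (decidable_of_em_type v))"
  by (simp only: decidable_of_em_def decidable_of_em_type_def
      certified typecheck cong: typecheck_cong)

declare decidable_of_em_type_def [certified]

definition em_of_stable_poset_type :: "nat \<Rightarrow> nat \<Rightarrow> nat \<Rightarrow> tm" where
  "em_of_stable_poset_type v u t =
    positive_poset stable_equality v u t \<rightarrow> excluded_middle v"

definition em_of_stable_poset :: "nat \<Rightarrow> nat \<Rightarrow> nat \<Rightarrow> tm" where
  "em_of_stable_poset v u t = asc (em_of_stable_poset_type v u t)
    (Lam
       (em_of_stable v u t \<cdot> Proj1 (Var 0) \<cdot> Proj1 (Proj2 (Var 0)) \<cdot>
          Proj1 (Proj2 (Proj2 (Var 0))) \<cdot> Proj1 (Proj2 (Proj2 (Proj2 (Var 0)))) \<cdot>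
          Proj1 (Proj2 (Proj2 (Proj2 (Proj2 (Var 0))))) \<cdot>
          Proj2 (Proj2 (Proj2 (Proj2 (Proj2 (Proj2 (Var 0))))))))"

lemma em_of_stable_poset_closed [certified]:
  "rename r (em_of_stable_poset v u t) = em_of_stable_poset v u t"
  "subst s (em_of_stable_poset v u t) = em_of_stable_poset v u t"
  "lam_of (em_of_stable_poset v u t) = None"
  by (simp_all only: em_of_stable_poset_def em_of_stable_poset_type_def certified typecheck)

lemma run_em_of_stable_poset [certified]:
  "run layer2 m \<Gamma> (em_of_stable_poset v u t) =
    accept layer2 m \<Gamma> (Some (em_of_stable_poset_type v u t))"
  by (simp only: em_of_stable_poset_def em_of_stable_poset_type_def
      certified typecheck cong: typecheck_cong)

declare em_of_stable_poset_type_def [certified]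

definition stable_of_decidable_poset_type :: "nat \<Rightarrow> nat \<Rightarrow> nat \<Rightarrow> tm" where
  "stable_of_decidable_poset_type v u t =
    positive_poset decidable_equality v u t \<rightarrow> positive_poset stable_equality v u t"

definition stable_of_decidable_poset :: "nat \<Rightarrow> nat \<Rightarrow> nat \<Rightarrow> tm" where
  "stable_of_decidable_poset v u t = asc (stable_of_decidable_poset_type v u t)
    (Lam
       (Tup (Proj1 (Var 0))
          (Tup (Proj1 (Proj2 (Var 0)))
             (Tup (Proj1 (Proj2 (Proj2 (Var 0))))
                (Tup (Proj1 (Proj2 (Proj2 (Proj2 (Var 0)))))
                   (Tup (Proj1 (Proj2 (Proj2 (Proj2 (Proj2 (Var 0))))))
                      (Tup (Proj1 (Proj2 (Proj2 (Proj2 (Proj2 (Proj2 (Var 0)))))))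
                         (lams 3
                            (CaseOf (Eq (Proj1 (Var 4)) (Var 3) (Var 2)) (Var 0)
                               (Abort (Eq (Proj1 (Var 5)) (Var 4) (Var 3)) (Var 1 \<cdot> Var 0))
                               (Proj2 (Proj2 (Proj2 (Proj2 (Proj2 (Proj2 (Var 3)))))) \<cdot> Var 2 \<cdot>
                                  Var 1))))))))))"

lemma stable_of_decidable_poset_closed [certified]:
  "rename r (stable_of_decidable_poset v u t) = stable_of_decidable_poset v u t"
  "subst s (stable_of_decidable_poset v u t) = stable_of_decidable_poset v u t"
  "lam_of (stable_of_decidable_poset v u t) = None"
  by (simp_all only: stable_of_decidable_poset_def stable_of_decidable_poset_type_def
      certified typecheck)

lemma run_stable_of_decidable_poset [certified]:
  "run layer2 m \<Gamma> (stable_of_decidable_poset v u t) =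
    accept layer2 m \<Gamma> (Some (stable_of_decidable_poset_type v u t))"
  by (simp only: stable_of_decidable_poset_def stable_of_decidable_poset_type_def
      certified typecheck cong: typecheck_cong)

declare stable_of_decidable_poset_type_def [certified]


section \<open>The equivalences\<close>

definition closed_tm :: "tm \<Rightarrow> bool" where
  "closed_tm A \<longleftrightarrow> (\<forall>r. rename r A = A) \<and> (\<forall>s. subst s A = A)"

lemma closed_tm_simps:
  "closed_tm A \<Longrightarrow> rename r A = A"
  "closed_tm A \<Longrightarrow> subst s A = A"
  by (simp_all add: closed_tm_def)

text \<open>Quantifying over contexts stands in for weakening: in a composition both functions are
  used under the new variable of type \<open>A\<close>.\<close>

definition derivable :: "tm \<Rightarrow> tm \<Rightarrow> bool" where
  "derivable A B \<longleftrightarrow> (\<exists>f. \<forall>\<Gamma>. wf \<Gamma> \<longrightarrow> \<Gamma> \<turnstile> f \<Colon> A \<rightarrow> B)"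

definition closed_type :: "tm \<Rightarrow> bool" where
  "closed_type A \<longleftrightarrow> closed_tm A \<and> (\<forall>\<Gamma>. wf \<Gamma> \<longrightarrow> (\<exists>i. \<Gamma> \<turnstile> A \<Colon> Univ i))"

lemma derivable_trans:
  assumes "closed_type A" "closed_type B" "closed_type C" "derivable A B" "derivable B C"
  shows "derivable A C"
proof -
  from assms(4,5) obtain f g
    where f: "\<And>\<Gamma>. wf \<Gamma> \<Longrightarrow> \<Gamma> \<turnstile> f \<Colon> A \<rightarrow> B" and g: "\<And>\<Gamma>. wf \<Gamma> \<Longrightarrow> \<Gamma> \<turnstile> g \<Colon> B \<rightarrow> C"
    unfolding derivable_def by blast
  have cl: "closed_tm A" "closed_tm B" "closed_tm C"
    using assms(1-3) by (simp_all add: closed_type_def)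
  have "\<Gamma> \<turnstile> Lam (g \<cdot> (f \<cdot> Var 0)) \<Colon> A \<rightarrow> C" if "wf \<Gamma>" for \<Gamma>
  proof -
    from assms(1) that obtain i where A: "\<Gamma> \<turnstile> A \<Colon> Univ i"
      unfolding closed_type_def by blast
    with that have wf: "wf (A # \<Gamma>)"
      by (rule wf_Cons)
    from ty_Var[OF wf, of 0] have "A # \<Gamma> \<turnstile> Var 0 \<Colon> A"
      by (simp add: closed_tm_simps cl)
    from ty_App[OF f[OF wf] this] have "A # \<Gamma> \<turnstile> f \<cdot> Var 0 \<Colon> B"
      by (simp add: inst_def closed_tm_simps cl)
    from ty_App[OF g[OF wf] this] have "A # \<Gamma> \<turnstile> g \<cdot> (f \<cdot> Var 0) \<Colon> C"
      by (simp add: inst_def closed_tm_simps cl)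
    with A show ?thesis
      by (auto intro: ty_Lam simp: closed_tm_simps cl)
  qed
  then show ?thesis
    unfolding derivable_def by blast
qed

lemma closed_typeI:
  assumes "\<And>r. rename r A = A" "\<And>s. subst s A = A" "\<And>\<Gamma>. fst (layer n) \<Gamma> A"
  shows "closed_type A"
  using assms sound_type[OF sound_layer] unfolding closed_type_def closed_tm_def by blast

lemma closed_type_em: "closed_type (excluded_middle v)"
  by (rule closed_typeI[where n = "Suc (Suc 0)"]; simp only: typecheck cong: typecheck_cong)

lemma closed_type_stable: "closed_type (positive_poset stable_equality v u t)"
  by (rule closed_typeI[where n = "Suc (Suc 0)"]; simp only: typecheck cong: typecheck_cong)

lemma closed_type_decidable: "closed_type (positive_poset decidable_equality v u t)"
  by (rule closed_typeI[where n = "Suc (Suc 0)"]; simp only: typecheck cong: typecheck_cong)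

lemma derivable_stable_em: "derivable (positive_poset stable_equality v u t) (excluded_middle v)"
  using run_layer_typing[OF run_em_of_stable_poset[where m = Synth, unfolded accept_simps]]
  unfolding derivable_def em_of_stable_poset_type_def by blast

lemma derivable_decidable_stable:
  "derivable (positive_poset decidable_equality v u t) (positive_poset stable_equality v u t)"
  using run_layer_typing[OF run_stable_of_decidable_poset[where m = Synth, unfolded accept_simps]]
  unfolding derivable_def stable_of_decidable_poset_type_def by blast

lemma derivable_em_decidable:
  "derivable (excluded_middle v) (positive_poset decidable_equality v 0 v)"
  using run_layer_typing[OF run_decidable_of_em[where m = Synth, unfolded accept_simps]]
  unfolding derivable_def decidable_of_em_type_def by blast

lemma entailsI:
  assumes "\<And>A. A \<in> \<A> \<Longrightarrow> \<exists>B\<in>\<B>. derivable A B"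
  shows "entails \<A> \<B>"
  using assms wf_Nil unfolding entails_def derivable_def by meson

theorem theorem4p27:
  fixes v :: nat
  shows "equivalent (stable_poset_exists v) (decidable_poset_exists v) \<and>
    equivalent (decidable_poset_exists v) {excluded_middle v} \<and>
    equivalent (stable_poset_exists v) {excluded_middle v}"
proof -
  have "derivable (positive_poset decidable_equality v u t) (excluded_middle v)" for u t
    by (rule derivable_trans[OF closed_type_decidable closed_type_stable closed_type_em
          derivable_decidable_stable derivable_stable_em])
  then have de: "entails (decidable_poset_exists v) {excluded_middle v}"
    by (intro entailsI) (auto simp: decidable_poset_exists_def)
  \<comment> \<open>Whatever the levels \<open>u\<close> and \<open>t\<close> of the given poset,
    the one obtained through excluded middle lives at levels \<open>0\<close> and
    \<open>v\<close>.\<close>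
  have "derivable (positive_poset stable_equality v u t)
      (positive_poset decidable_equality v 0 v)" for u t
    by (rule derivable_trans[OF closed_type_stable closed_type_em closed_type_decidable
          derivable_stable_em derivable_em_decidable])
  then have sd: "entails (stable_poset_exists v) (decidable_poset_exists v)"
    by (intro entailsI) (unfold stable_poset_exists_def decidable_poset_exists_def, blast)
  have "derivable (excluded_middle v) (positive_poset stable_equality v 0 v)"
    by (rule derivable_trans[OF closed_type_em closed_type_decidable closed_type_stable
          derivable_em_decidable derivable_decidable_stable])
  then have es: "entails {excluded_middle v} (stable_poset_exists v)"
    by (intro entailsI) (unfold stable_poset_exists_def, blast)
  have ds: "entails (decidable_poset_exists v) (stable_poset_exists v)"
    using derivable_decidable_stable
    by (intro entailsI) (unfold stable_poset_exists_def decidable_poset_exists_def, blast)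
  have se: "entails (stable_poset_exists v) {excluded_middle v}"
    using derivable_stable_em by (intro entailsI) (auto simp: stable_poset_exists_def)
  have ed: "entails {excluded_middle v} (decidable_poset_exists v)"
    using derivable_em_decidable by (intro entailsI) (unfold decidable_poset_exists_def, blast)
  from de sd es ds se ed show ?thesis
    by (simp add: equivalent_def)
qed

end
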